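(* Let $\mathcal K$ be a long virtual knot and $A$ an abelian group. (1) Let $p$ be an oriented parity with coefficients in $A$ on the diagrams of $\mathcal K$. Then the formula $\delta^p_D=\sum_{a\in\mathcal A(D)}\delta_a\cdot a$ (with $\delta_a$ defined from $p$ as in the context) defines an invariant 1-cycle $\delta^p_D\in H_1(D,A)$ such that for every diagram $D$ of $\mathcal K$ and every $v\in\mathcal V(D)$ $$p_D(v)=-o(v)\cdot D^c_v\cdot\delta^p_D.$$ (2) Given an invariant 1-cycle $\delta$ on the diagrams of $\mathcal K$ with coefficients in $A$, the formula $$p^\delta_D(v)=-o(v)\cdot D^c_v\cdot\delta_D$$ defines an oriented parity $p^\delta$ on the diagrams of $\mathcal K$ with coefficients in $A$.
   Context: Long knots. A long virtual knot diagram $D$ is a generic immersion of the oriented line $\mathbb R$ into $\mathbb R^2$ coinciding with the axis $Ox$ outside a large disc, each double point being marked classical (with over/under information) or virtual. A long virtual knot is a class of such diagrams modulo isotopy, classical Reidemeister moves R1, R2, R3 and detour moves (replacing a path containing only virtual crossings by another path with the same ends containing only virtual crossings). $\mathcal V(D)$ is the set of classical crossings; $\mathcal A(D)$ is the set of arcs, i.e. pieces of $D$ between consecutive classical crossings, including the two unbounded end pieces. A move $f\colon D\to D'$ induces a partial bijection $f_*\colon\mathcal V(D)\to\mathcal V(D')$ between surviving crossings. Arcs $a\in\mathcal A(D)$, $a'\in\mathcal A(D')$ are correspondent under a Reidemeister move if they share a point outside the region of the move; isotopies and detour moves induce a bijection of arcs. Local picture. Draw a classical crossing $v$ with both strands directed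 upward: the incoming arcs are SW, SE, the outgoing ones NW, NE, and the strands run SW$\to$NE and SE$\to$NW. The oriented smoothing at $v$ splits $D$ into the left half $D^l_v$ (containing the NW and SW ends at $v$) and the right half $D^r_v$ (containing the NE and SE ends). One half is a closed path, the closed half $D^c_v$; the other is the open half. The order is $o(v)=1$ if $D^c_v=D^r_v$ and $o(v)=-1$ if $D^c_v=D^l_v$. Chains. $C_1(D,A)$ is the group of $A$-linear combinations of arcs; $H_1(D,A)$ is the subgroup of 1-cycles: at each classical crossing the sum of the values on the incoming arcs equals the sum on the outgoing arcs. For a closed path $C$ in $D$ and a 1-cycle $\delta$, $C\cdot\delta\in A$ is the intersection number on the oriented ribbon surface of $D$ (virtual crossings ignored): push $C$ off $D$ and sum the values of $\delta$ at the transverse intersections with sign $+1$ when (tangent of $C$, tangent of arc) is positively oriented and $-1$ otherwise. A family $\gamma_D\in C_1(D,A)$ is invariant if $\gamma_D(a)=\gamma_{D'}(a')$ for every move $D\to D'$ and all correspondent arcs $a,a'$. Oriented parity. A family of maps $p_D\colon\mathcal V(D)\to A$ for all diagrams $D$ of $\mathcal K$ such that: (P0) $p_D(v)=p_{D'}(f_*(v))$ for every move $f\colon D\to D'$ and every $v$ for which $f_*(v)$ exists; (P1) $p_D(v)=0$ if $v$ disappears in a decreasing R1; (P2) $p_D(v_1)+p_D(v_2)=0$ if $v_1,v_2$ disappear in a decreasing R2; (P3+) $\sum_{i=1}^3\epsilon_\Delta(v_i)p_D(v_i)=0$ if $v_1,v_2,v_3$ are the vertices of the disappearing triangle $\Delta$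 of an R3, where $\epsilon_\Delta(v)=+1$ if $\Delta$ lies to the left or right of $v$ in the local picture (between SW and NW, or between SE and NE) and $-1$ if it lies above or below $v$. The values $\delta_a$. For $a\in\mathcal A(D)$ take two disjoint subsegments of $a$, bring them by detour moves side by side, parallel and in the same direction, and apply an increasing R2 to them. Let $v$ be the new crossing at which both strands enter the new bigon; $\delta_a$ is the value of $p$ at $v$ (it does not depend on the choices). *)

theory Defs
  imports Main
begin

text \<open>
  Long virtual knot diagrams are encoded by long signed Gauss codes: the list of passages
  through classical crossings, in the order in which the oriented line meets them.
  Virtual crossings and the planar position are not recorded.  A Gauss code is the same thing as
  a diagram up to isotopy and detour moves, and every Gauss code is realised by such a diagram;
  the only trace that those moves leave is a renaming of crossings.
\<close>

datatype passage = Passage (crossing: nat) (over: bool) (positive: bool)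

type_synonym diagram = "passage list"

fun opposite :: "passage \<Rightarrow> passage" where
  "opposite (Passage v b s) = Passage v (\<not> b) s"

definition long_diagram :: "diagram \<Rightarrow> bool" where
  "long_diagram D \<longleftrightarrow>
     distinct (map (\<lambda>x. (crossing x, over x)) D) \<and> (\<forall>x \<in> set D. opposite x \<in> set D)"

definition vertices :: "diagram \<Rightarrow> nat set" where
  "vertices D = crossing ` set D"

text \<open>Arc \<open>k\<close> ends at the passage \<open>D ! k\<close> and starts at \<open>D ! (k - 1)\<close>; the arcs \<open>0\<close> and
  \<open>length D\<close> are unbounded.\<close>

definition arcs :: "diagram \<Rightarrow> nat set" where
  "arcs D = {..length D}"


section \<open>Local picture at a crossing\<close>

text \<open>Corners are the four ends at a crossing drawn with both strands upward.  At a positive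
  crossing the overpassing strand runs from SW to NE, at a negative one from SE to NW.\<close>

datatype corner = SW | SE | NE | NW

definition outgoing :: "corner \<Rightarrow> bool" where
  "outgoing h \<longleftrightarrow> h = NE \<or> h = NW"

fun clockwise :: "corner \<Rightarrow> corner" where
  "clockwise SW = NW"
| "clockwise NW = NE"
| "clockwise NE = SE"
| "clockwise SE = SW"

definition rising :: "passage \<Rightarrow> bool" where  \<comment> \<open>the passage runs from SW to NE\<close>
  "rising x \<longleftrightarrow> (over x \<longleftrightarrow> positive x)"

definition in_corner :: "passage \<Rightarrow> corner" where
  "in_corner x = (if rising x then SW else SE)"

definition out_corner :: "passage \<Rightarrow> corner" where
  "out_corner x = (if rising x then NE else NW)"

definition position :: "diagram \<Rightarrow> nat \<Rightarrow> bool \<Rightarrow> nat" where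
  "position D v r = (THE k. k < length D \<and> crossing (D ! k) = v \<and> rising (D ! k) = r)"

fun arc_at :: "diagram \<Rightarrow> nat \<Rightarrow> corner \<Rightarrow> nat" where
  "arc_at D v SW = position D v True"
| "arc_at D v NE = Suc (position D v True)"
| "arc_at D v SE = position D v False"
| "arc_at D v NW = Suc (position D v False)"


section \<open>Reidemeister moves\<close>

text \<open>Each relation describes decreasing moves (for the third move: all moves) from the first
  diagram to the last; the set of pairs is the correspondence of arcs.\<close>

inductive R1 :: "diagram \<Rightarrow> nat \<Rightarrow> (nat \<times> nat) set \<Rightarrow> diagram \<Rightarrow> bool" where
  "long_diagram (u @ [x, opposite x] @ w) \<Longrightarrow>
   R1 (u @ [x, opposite x] @ w) (crossing x)
      ({(k, k) | k. k \<le> length u} \<union> {(k + 2, k) | k. length u \<le> k \<and> k \<le> length (u @ w)})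
      (u @ w)"

text \<open>In the second move one strand passes over the other at both crossings and the signs are
  opposite; the strands bounding the bigon run in the same or in opposite directions.\<close>

inductive R2 :: "diagram \<Rightarrow> nat \<Rightarrow> nat \<Rightarrow> (nat \<times> nat) set \<Rightarrow> diagram \<Rightarrow> bool" where
  "long_diagram (u @ [x, y] @ m @ q @ w) \<Longrightarrow>
   over x = over y \<Longrightarrow> positive x \<noteq> positive y \<Longrightarrow>
   q = [opposite x, opposite y] \<or> q = [opposite y, opposite x] \<Longrightarrow>
   R2 (u @ [x, y] @ m @ q @ w) (crossing x) (crossing y)
      ({(k, k) | k. k \<le> length u} \<union>
       {(k + 2, k) | k. length u \<le> k \<and> k \<le> length (u @ m)} \<union>
       {(k + 4, k) | k. length (u @ m) \<le> k \<and> k \<le> length (u @ m @ w)})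
      (u @ m @ w)"

text \<open>Faces of the ribbon surface: a pair \<open>(k, f)\<close> is the arc \<open>k\<close> traversed along (\<open>f\<close>) or
  against (\<open>\<not> f\<close>) its orientation.  Having reached a crossing at the end \<open>h\<close>, a walk that keeps
  a face on its left continues along the end \<open>clockwise h\<close>; the face occupies the sector between
  these two ends.\<close>

definition arrival :: "diagram \<Rightarrow> nat \<times> bool \<Rightarrow> nat \<times> corner" where
  "arrival D d = (case d of (k, f) \<Rightarrow>
     if f then (crossing (D ! k), in_corner (D ! k))
     else (crossing (D ! (k - 1)), out_corner (D ! (k - 1))))"

definition turn_left :: "diagram \<Rightarrow> nat \<times> bool \<Rightarrow> nat \<times> bool" where
  "turn_left D d =
     (case arrival D d of (v, h) \<Rightarrow> (arc_at D v (clockwise h), outgoing (clockwise h)))"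

definition triangle :: "diagram \<Rightarrow> nat \<times> bool \<Rightarrow> nat \<times> bool \<Rightarrow> nat \<times> bool \<Rightarrow> bool" where
  "triangle D d1 d2 d3 \<longleftrightarrow>
     fst d1 \<in> {0<..<length D} \<and> fst d2 \<in> {0<..<length D} \<and> fst d3 \<in> {0<..<length D} \<and>
     turn_left D d1 = d2 \<and> turn_left D d2 = d3 \<and> turn_left D d3 = d1 \<and>
     distinct [fst (arrival D d1), fst (arrival D d2), fst (arrival D d3)]"

text \<open>The sector between \<open>h\<close> and \<open>clockwise h\<close> is the left one for SW, the right one for NE,
  the one above for NW and the one below for SE.\<close>

definition triangle_sign :: "diagram \<Rightarrow> nat \<times> bool \<Rightarrow> int" where
  "triangle_sign D d = (if snd (arrival D d) \<in> {SW, NE} then 1 else - 1)"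

definition swap_ends :: "nat \<Rightarrow> diagram \<Rightarrow> diagram" where
  "swap_ends k D = D[k - 1 := D ! k, k := D ! (k - 1)]"

text \<open>In the third move one of the three strands is on top and one at the bottom, and the two
  passages at the ends of each side of the triangle change places.\<close>

inductive R3 :: "diagram \<Rightarrow> nat \<times> bool \<Rightarrow> nat \<times> bool \<Rightarrow> nat \<times> bool \<Rightarrow>
    (nat \<times> nat) set \<Rightarrow> diagram \<Rightarrow> bool" where
  "long_diagram D \<Longrightarrow> triangle D d1 d2 d3 \<Longrightarrow>
   \<exists>k \<in> {fst d1, fst d2, fst d3}. over (D ! (k - 1)) \<and> over (D ! k) \<Longrightarrow>
   \<exists>k \<in> {fst d1, fst d2, fst d3}. \<not> over (D ! (k - 1)) \<and> \<not> over (D ! k) \<Longrightarrow>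
   R3 D d1 d2 d3 (Id_on (arcs D - {fst d1, fst d2, fst d3}))
      (swap_ends (fst d1) (swap_ends (fst d2) (swap_ends (fst d3) D)))"

fun rename :: "(nat \<Rightarrow> nat) \<Rightarrow> passage \<Rightarrow> passage" where
  "rename f (Passage v b s) = Passage (f v) b s"

text \<open>\<open>move D F A D'\<close>: a move from \<open>D\<close> to \<open>D'\<close> with partial bijection \<open>F\<close> of crossings and
  correspondence \<open>A\<close> of arcs.  The first rule stands for isotopies and detour moves.\<close>

inductive move :: "diagram \<Rightarrow> (nat \<times> nat) set \<Rightarrow> (nat \<times> nat) set \<Rightarrow> diagram \<Rightarrow> bool" where
  renaming: "long_diagram D \<Longrightarrow> inj_on f (vertices D) \<Longrightarrow>
    move D {(v, f v) | v. v \<in> vertices D} (Id_on (arcs D)) (map (rename f) D)"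
| first: "R1 D v A D' \<Longrightarrow> move D (Id_on (vertices D')) A D'"
| second: "R2 D v w A D' \<Longrightarrow> move D (Id_on (vertices D')) A D'"
| third: "R3 D d1 d2 d3 A D' \<Longrightarrow> move D (Id_on (vertices D)) A D'"
| inverse: "move D F A D' \<Longrightarrow> move D' (F\<inverse>) (A\<inverse>) D"

definition same_knot :: "(diagram \<times> diagram) set" where
  "same_knot = {(D, D'). long_diagram D \<and> long_diagram D' \<and>
     (\<lambda>E E'. \<exists>F A. move E F A E')\<^sup>*\<^sup>* D D'}"

definition long_virtual_knots :: "diagram set set" where
  "long_virtual_knots = {D. long_diagram D} // same_knot"

lemma equiv_same_knot: "equiv {D. long_diagram D} same_knot"
proof (rule equivI)
  have "symp (\<lambda>E E'. \<exists>F A. move E F A E')"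
    by (auto intro!: sympI intro: move.inverse)
  then have "symp ((\<lambda>E E'. \<exists>F A. move E F A E')\<^sup>*\<^sup>*)"
    by (rule symp_rtranclp)
  then show "sym same_knot"
    by (auto simp: same_knot_def sym_def dest: sympD)
qed (auto simp: same_knot_def refl_on_def trans_def)


section \<open>Halves of a diagram at a crossing\<close>

text \<open>The end along which one leaves after arriving along arc \<open>k\<close>: turn at \<open>v\<close> as prescribed
  by the oriented smoothing (SW to NW, SE to NE), go straight at all other crossings.\<close>

definition smoothed_exit :: "diagram \<Rightarrow> nat \<Rightarrow> nat \<Rightarrow> corner" where
  "smoothed_exit D v k =
     (if crossing (D ! k) = v then (if rising (D ! k) then NW else NE) else out_corner (D ! k))"

definition smoothed_step :: "diagram \<Rightarrow> nat \<Rightarrow> (nat \<times> nat) set" where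
  "smoothed_step D v =
     {(k, arc_at D (crossing (D ! k)) (smoothed_exit D v k)) | k. k < length D}"

definition left_half :: "diagram \<Rightarrow> nat \<Rightarrow> nat set" where
  "left_half D v = {k. (arc_at D v SW, k) \<in> (smoothed_step D v \<union> (smoothed_step D v)\<inverse>)\<^sup>*}"

definition right_half :: "diagram \<Rightarrow> nat \<Rightarrow> nat set" where
  "right_half D v = {k. (arc_at D v NE, k) \<in> (smoothed_step D v \<union> (smoothed_step D v)\<inverse>)\<^sup>*}"

definition closed_half :: "diagram \<Rightarrow> nat \<Rightarrow> nat set" where
  "closed_half D v = (if 0 \<in> left_half D v then right_half D v else left_half D v)"

definition knot_order :: "diagram \<Rightarrow> nat \<Rightarrow> int" where
  "knot_order D v = (if closed_half D v = right_half D v then 1 else - 1)"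

text \<open>An oriented closed path is given by its passages: \<open>(k, h)\<close> means that the path reaches the
  end of the bounded arc \<open>k\<close> and leaves the crossing there along the end \<open>h\<close>.\<close>

definition closed_half_path :: "diagram \<Rightarrow> nat \<Rightarrow> (nat \<times> corner) set" where
  "closed_half_path D v = {(k, smoothed_exit D v k) | k. k \<in> closed_half D v}"


section \<open>Chains and the intersection number\<close>

text \<open>A chain is a function on arc indices that vanishes outside the arcs of the diagram.\<close>

definition C1 :: "diagram \<Rightarrow> (nat \<Rightarrow> 'a::ab_group_add) set" where
  "C1 D = {\<gamma>. \<forall>k. k \<notin> arcs D \<longrightarrow> \<gamma> k = 0}"

definition H1 :: "diagram \<Rightarrow> (nat \<Rightarrow> 'a::ab_group_add) set" where
  "H1 D = {\<gamma> \<in> C1 D. \<forall>v \<in> vertices D.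
     \<gamma> (arc_at D v SW) + \<gamma> (arc_at D v SE) = \<gamma> (arc_at D v NW) + \<gamma> (arc_at D v NE)}"

text \<open>The path is pushed off the diagram to its left.  When it passes a crossing from the end
  \<open>h\<close> to the end \<open>h'\<close>, the pushed copy goes clockwise around the crossing and meets the ends
  strictly between \<open>h\<close> and \<open>h'\<close>; its tangent and an outgoing (incoming) arc form a positive
  (negative) frame.  Only passages along the orientation occur.  For 1-cycles the push to the
  right gives the same value.\<close>

fun ends_between :: "corner \<Rightarrow> corner \<Rightarrow> corner set" where
  "ends_between SW NW = {}"
| "ends_between SW NE = {NW}"
| "ends_between SE NW = {SW}"
| "ends_between SE NE = {SW, NW}"
| "ends_between _ _ = {}"

definition intersection :: "diagram \<Rightarrow> (nat \<times> corner) set \<Rightarrow> (nat \<Rightarrow> 'a::ab_group_add) \<Rightarrow> 'a" where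
  "intersection D C \<gamma> =
     (\<Sum>(k, h) \<in> C. \<Sum>g \<in> ends_between (in_corner (D ! k)) h.
        if outgoing g then \<gamma> (arc_at D (crossing (D ! k)) g)
        else - \<gamma> (arc_at D (crossing (D ! k)) g))"

definition invariant_cycle :: "diagram set \<Rightarrow> (diagram \<Rightarrow> nat \<Rightarrow> 'a::ab_group_add) \<Rightarrow> bool" where
  "invariant_cycle K \<gamma> \<longleftrightarrow>
     (\<forall>D \<in> K. \<gamma> D \<in> H1 D) \<and>
     (\<forall>D \<in> K. \<forall>D' \<in> K. \<forall>F A. move D F A D' \<longrightarrow> (\<forall>(a, a') \<in> A. \<gamma> D a = \<gamma> D' a'))"


section \<open>Oriented parities\<close>

definition zscale :: "int \<Rightarrow> 'a::ab_group_add \<Rightarrow> 'a" where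
  "zscale n x = (if 0 \<le> n then \<Sum>i<nat n. x else - (\<Sum>i<nat (- n). x))"

definition oriented_parity :: "diagram set \<Rightarrow> (diagram \<Rightarrow> nat \<Rightarrow> 'a::ab_group_add) \<Rightarrow> bool" where
  "oriented_parity K p \<longleftrightarrow>
     (\<forall>D \<in> K. \<forall>D' \<in> K. \<forall>F A. move D F A D' \<longrightarrow> (\<forall>(v, v') \<in> F. p D v = p D' v')) \<and>
     (\<forall>D \<in> K. \<forall>D' \<in> K. \<forall>v A. R1 D v A D' \<longrightarrow> p D v = 0) \<and>
     (\<forall>D \<in> K. \<forall>D' \<in> K. \<forall>v1 v2 A. R2 D v1 v2 A D' \<longrightarrow> p D v1 + p D v2 = 0) \<and>
     (\<forall>D \<in> K. \<forall>D' \<in> K. \<forall>d1 d2 d3 A. R3 D d1 d2 d3 A D' \<longrightarrow>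
        (\<Sum>d \<leftarrow> [d1, d2, d3]. zscale (triangle_sign D d) (p D (fst (arrival D d)))) = 0)"

text \<open>\<open>doubling D a E v\<close>: \<open>E\<close> arises from \<open>D\<close> by an increasing second move applied to two
  parallel subsegments of the arc \<open>a\<close>, and \<open>v\<close> is the crossing at which both enter the bigon.\<close>

inductive doubling :: "diagram \<Rightarrow> nat \<Rightarrow> diagram \<Rightarrow> nat \<Rightarrow> bool" where
  "R2 (u @ [x, y] @ [opposite x, opposite y] @ w) (crossing x) (crossing y) A (u @ w) \<Longrightarrow>
   doubling (u @ w) (length u) (u @ [x, y] @ [opposite x, opposite y] @ w) (crossing x)"

definition parity_cycle :: "(diagram \<Rightarrow> nat \<Rightarrow> 'a::ab_group_add) \<Rightarrow> diagram \<Rightarrow> nat \<Rightarrow> 'a" where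
  "parity_cycle p D a =
     (if a \<in> arcs D then THE t. \<forall>E v. doubling D a E v \<longrightarrow> p E v = t else 0)"

definition cycle_parity :: "(diagram \<Rightarrow> nat \<Rightarrow> 'a::ab_group_add) \<Rightarrow> diagram \<Rightarrow> nat \<Rightarrow> 'a" where
  "cycle_parity \<gamma> D v =
     zscale (- knot_order D v) (intersection D (closed_half_path D v) (\<gamma> D))"

end

theory Submission
  imports Defs
begin

text \<open>
  Let \<open>\<gamma>\<close> be a 1-cycle on a diagram. The intersection number of \<open>\<gamma>\<close> with the closed half at
  \<open>v\<close> is a sum over the passages between the two passages through \<open>v\<close>. A long knot has a
  beginning, so this sum is a difference of two values of a function on arcs, the height: the
  intersection number with the initial piece of the line. Both orders of \<open>v\<close> lead to the
  expression \<open>\<gamma>(SW) + height(SW) - height(SE)\<close>, the index of \<open>v\<close> (\<open>intersection_closed_half\<close>).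

  The index has a description by faces. Give the arc \<open>k\<close> the potential \<open>height k\<close> if it is
  travelled along the line and \<open>height k + \<gamma> k\<close> if it is travelled backwards. On the boundary walk
  of a face, with the face on the left, the potential decreases at a vertex by the index times the sign
  \<open>\<epsilon>\<close> of the sector (\<open>potential_turn_left\<close>). The cycle condition says that the four sectors at a
  crossing agree. This is the face relation.

  If \<open>\<gamma>\<close> is invariant, the index is an oriented parity. Summing the face relation around a triangle
  gives (P3+). Under a first or second move the jumps of the height at the disappearing passages cancel,
  so the other heights and indices do not change and (P1), (P2) hold. Under a third move the potential
  on outer arcs is unchanged because of the cycle condition at the vertex opposite to the strand
  (\<open>potential_across\<close>), and the index of a vertex can be computed from outer arcs.

  Conversely, an oriented parity \<open>p\<close> determines a potential: push the beginning of the line over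
  the arc \<open>k\<close> and evaluate \<open>p\<close> at one of the two new crossings (\<open>finger\<close>, \<open>finger_value\<close>). It is
  invariant, since a move can be made in the presence of a finger (\<open>move_finger\<close>). Two fingers over
  neighbouring ends of \<open>v\<close> form a triangle with \<open>v\<close>, and (P3+) for it is the face relation for
  \<open>p\<close> and this potential (\<open>face_relation\<close>). Let \<open>\<gamma> k\<close> be the difference of the potentials of
  the arc \<open>k\<close> for the two directions of travel. The face relation at the new crossing of a doubled arc
  shows that \<open>\<gamma> k\<close> is its parity, that is \<open>\<delta>\<^sub>k\<close>, whatever doubling is chosen. The four sectors
  at a crossing give the cycle condition and show that the potential along the line changes by the jumps
  of the height. On the first arc it is \<open>0\<close> by (P1). Hence it is the height, and \<open>p\<close> is the index.
\<close>


section \<open>Passages and their positions\<close>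

lemma opposite_simps [simp]:
  "crossing (opposite x) = crossing x"
  "over (opposite x) \<longleftrightarrow> \<not> over x"
  "positive (opposite x) = positive x"
  "opposite (opposite x) = x"
  "rising (opposite x) \<longleftrightarrow> \<not> rising x"
  by (cases x; auto simp: rising_def)+

lemma rename_simps [simp]:
  "crossing (rename f x) = f (crossing x)"
  "over (rename f x) = over x"
  "positive (rename f x) = positive x"
  "rising (rename f x) = rising x"
  "rename f (opposite x) = opposite (rename f x)"
  by (cases x; auto simp: rising_def)+

lemma zscale_simps [simp]: "zscale 1 x = x" "zscale (- 1) x = - x"
  by (simp_all add: zscale_def)

lemma long_diagram_over_unique:
  assumes "long_diagram D" "k < length D" "l < length D"
    and "crossing (D ! k) = crossing (D ! l)" "over (D ! k) = over (D ! l)"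
  shows "k = l"
  using assms by (auto simp: long_diagram_def distinct_conv_nth)

text \<open>If the two passages differed in being over, their signs would differ as well; but the passage
  opposite to the first one has the sign of the first and is over if the second is.\<close>

lemma long_diagram_rising_unique:
  assumes "long_diagram D" "k < length D" "l < length D"
    and "crossing (D ! k) = crossing (D ! l)" "rising (D ! k) = rising (D ! l)"
  shows "k = l"
proof (cases "over (D ! k) = over (D ! l)")
  case True
  then show ?thesis using long_diagram_over_unique assms by blast
next
  case False
  have "opposite (D ! k) \<in> set D" using assms by (auto simp: long_diagram_def)
  then obtain m where m: "m < length D" "D ! m = opposite (D ! k)" by (auto simp: in_set_conv_nth)
  have "m = l"
    by (rule long_diagram_over_unique[OF assms(1) m(1) assms(3)]) (use m(2) assms(4) False in simp_all)
  then show ?thesis using m(2) assms(5) by simp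
qed

lemma position_eqI:
  assumes "long_diagram D" "k < length D" "crossing (D ! k) = v" "rising (D ! k) = r"
  shows "position D v r = k"
  unfolding position_def using assms long_diagram_rising_unique by (intro the_equality) auto

lemma position:
  assumes "long_diagram D" "v \<in> vertices D"
  shows position_less: "position D v r < length D"
    and crossing_position: "crossing (D ! position D v r) = v"
    and rising_position: "rising (D ! position D v r) = r"
proof -
  obtain x where x: "x \<in> set D" "crossing x = v" using assms by (auto simp: vertices_def)
  then have "opposite x \<in> set D" using assms by (auto simp: long_diagram_def)
  with x obtain y where "y \<in> set D" "crossing y = v" "rising y = r"
    by (cases "rising x = r") auto
  then obtain k where k: "k < length D" "crossing (D ! k) = v" "rising (D ! k) = r"
    by (auto simp: in_set_conv_nth)
  then have "position D v r = k" using position_eqI assms by blast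
  with k show "position D v r < length D" "crossing (D ! position D v r) = v"
    "rising (D ! position D v r) = r" by auto
qed

lemma nth_in_vertices [intro]: "k < length D \<Longrightarrow> crossing (D ! k) \<in> vertices D"
  by (auto simp: vertices_def)

lemma position_inj:
  assumes "long_diagram D" "v \<in> vertices D" "w \<in> vertices D" "position D v r = position D w s"
  shows "v = w \<and> r = s"
  using assms crossing_position[of D v r] crossing_position[of D w s]
    rising_position[of D v r] rising_position[of D w s] by simp

lemma arc_at_in_arcs: "long_diagram D \<Longrightarrow> v \<in> vertices D \<Longrightarrow> arc_at D v h \<in> arcs D"
  using position_less[of D v] by (cases h) (auto simp: arcs_def less_imp_le Suc_le_eq)


section \<open>Darts\<close>

text \<open>A dart is an arc with a direction of travel, in the encoding used for faces. Every dart that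
  reaches a crossing arrives along one of its four ends (\<open>arrival_cases\<close>), so that statements
  about faces become statements about the corners of a crossing.\<close>

definition toward :: "diagram \<Rightarrow> nat \<Rightarrow> corner \<Rightarrow> nat \<times> bool" where
  "toward D v h = (arc_at D v h, \<not> outgoing h)"

definition away :: "diagram \<Rightarrow> nat \<Rightarrow> corner \<Rightarrow> nat \<times> bool" where
  "away D v h = (arc_at D v h, outgoing h)"

text \<open>The strand to which an end belongs, named by the value of \<open>rising\<close> at its passage.\<close>

definition strand :: "corner \<Rightarrow> bool" where
  "strand h \<longleftrightarrow> h \<in> {SW, NE}"

text \<open>The sign \<open>\<epsilon>\<^sub>\<Delta>\<close> of a face that occupies the sector between \<open>h\<close> and \<open>clockwise h\<close>.\<close>

definition corner_sign :: "corner \<Rightarrow> int" where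
  "corner_sign h = (if h \<in> {SW, NE} then 1 else - 1)"

lemma triangle_sign_eq: "triangle_sign D d = corner_sign (snd (arrival D d))"
  by (simp add: triangle_sign_def corner_sign_def)

lemma outgoing_simps [simp]: "outgoing NE" "outgoing NW" "\<not> outgoing SE" "\<not> outgoing SW"
  by (simp_all add: outgoing_def)

lemma arrival_toward:
  assumes "long_diagram D" "v \<in> vertices D"
  shows "arrival D (toward D v h) = (v, h)"
  using position[OF assms]
  by (cases h) (auto simp: toward_def arrival_def in_corner_def out_corner_def)

lemma turn_left_toward:
  assumes "long_diagram D" "v \<in> vertices D"
  shows "turn_left D (toward D v h) = away D v (clockwise h)"
  using arrival_toward[OF assms, of h] by (simp add: turn_left_def away_def)

definition reaches :: "diagram \<Rightarrow> nat \<times> bool \<Rightarrow> bool" where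
  "reaches D d \<longleftrightarrow> (if snd d then fst d < length D else 0 < fst d \<and> fst d \<le> length D)"

lemma arrival_cases:
  assumes "long_diagram D" "reaches D d" "arrival D d = (v, h)"
  shows "v \<in> vertices D" "d = toward D v h"
proof -
  obtain k f where d: "d = (k, f)" by force
  show "v \<in> vertices D" using assms
    by (auto simp: d reaches_def arrival_def split: if_splits)
  show "d = toward D v h"
  proof (cases f)
    case True
    then have k: "k < length D" "v = crossing (D ! k)" "h = in_corner (D ! k)"
      using assms by (auto simp: d reaches_def arrival_def)
    then show ?thesis using position_eqI[OF assms(1) k(1) refl refl] True
      by (auto simp: d toward_def in_corner_def)
  next
    case False
    then have k: "k - 1 < length D" "v = crossing (D ! (k - 1))" "h = out_corner (D ! (k - 1))"
        "0 < k"
      using assms by (auto simp: d reaches_def arrival_def)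
    then show ?thesis using position_eqI[OF assms(1) k(1) refl refl] False
      by (auto simp: d toward_def out_corner_def)
  qed
qed

lemma clockwise_simps [simp]:
  "outgoing (clockwise (clockwise h)) \<longleftrightarrow> \<not> outgoing h"
  "clockwise (clockwise (clockwise (clockwise h))) = h"
  "strand (clockwise h) \<longleftrightarrow> \<not> strand h"
  "corner_sign (clockwise h) = - corner_sign h"
  by (cases h; simp add: strand_def corner_sign_def)+


section \<open>Heights of arcs and the index of a crossing\<close>

text \<open>What a straight passage contributes to an intersection number: the path, pushed to its left,
  meets the outgoing end of the other strand if it is rising, and the incoming one otherwise.\<close>

definition jump :: "diagram \<Rightarrow> (nat \<Rightarrow> 'a::ab_group_add) \<Rightarrow> passage \<Rightarrow> 'a" where
  "jump D \<gamma> x =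
     (if rising x then \<gamma> (arc_at D (crossing x) NW) else - \<gamma> (arc_at D (crossing x) SW))"

text \<open>The intersection number of \<open>\<gamma>\<close> with the piece of the line that precedes the arc \<open>k\<close>. On a
  closed knot this would depend on a base point; a long knot has a beginning.\<close>

definition height :: "diagram \<Rightarrow> (nat \<Rightarrow> 'a::ab_group_add) \<Rightarrow> nat \<Rightarrow> 'a" where
  "height D \<gamma> k = (\<Sum>x \<leftarrow> take k D. jump D \<gamma> x)"

text \<open>The parity of \<open>v\<close> in terms of heights (\<open>intersection_closed_half\<close>). The same expression
  serves crossings of both orders.\<close>

definition crossing_index :: "diagram \<Rightarrow> (nat \<Rightarrow> 'a::ab_group_add) \<Rightarrow> nat \<Rightarrow> 'a" where
  "crossing_index D \<gamma> v =
     \<gamma> (arc_at D v SW) + height D \<gamma> (arc_at D v SW) - height D \<gamma> (arc_at D v SE)"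

lemma height_0 [simp]: "height D \<gamma> 0 = 0"
  by (simp add: height_def)

lemma height_Suc: "k < length D \<Longrightarrow> height D \<gamma> (Suc k) = height D \<gamma> k + jump D \<gamma> (D ! k)"
  by (simp add: height_def take_Suc_conv_app_nth)

lemma height_NE:
  assumes "long_diagram D" "v \<in> vertices D"
  shows "height D \<gamma> (arc_at D v NE) = height D \<gamma> (arc_at D v SW) + \<gamma> (arc_at D v NW)"
  using height_Suc[OF position_less[OF assms, of True], of \<gamma>] crossing_position[OF assms] rising_position[OF assms]
  by (simp add: jump_def)

lemma height_NW:
  assumes "long_diagram D" "v \<in> vertices D"
  shows "height D \<gamma> (arc_at D v NW) = height D \<gamma> (arc_at D v SE) - \<gamma> (arc_at D v SW)"
  using height_Suc[OF position_less[OF assms, of False], of \<gamma>] crossing_position[OF assms] rising_position[OF assms]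
  by (simp add: jump_def)

lemma sum_jump_height:
  assumes "a \<le> b" "b \<le> length D"
  shows "(\<Sum>k = a..<b. jump D \<gamma> (D ! k)) = height D \<gamma> b - height D \<gamma> a"
  using assms(1,2)
proof (induction b rule: dec_induct)
  case (step n)
  then show ?case by (simp add: height_Suc)
qed simp


section \<open>The closed half\<close>

definition smoothed_next :: "diagram \<Rightarrow> nat \<Rightarrow> nat \<Rightarrow> nat" where
  "smoothed_next D v k =
     (if k = position D v True then Suc (position D v False)
      else if k = position D v False then Suc (position D v True) else Suc k)"

lemma smoothed_step_eq:
  assumes "long_diagram D" "v \<in> vertices D"
  shows "smoothed_step D v = {(k, smoothed_next D v k) | k. k < length D}"
proof -
  have "arc_at D (crossing (D ! k)) (smoothed_exit D v k) = smoothed_next D v k"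
    if k: "k < length D" for k
  proof (cases "crossing (D ! k) = v")
    case True
    then have "position D v (rising (D ! k)) = k"
      using position_eqI[OF assms(1) k] by blast
    moreover have "position D v True \<noteq> position D v False"
      using position_inj[OF assms(1,2,2)] by blast
    ultimately show ?thesis using True
      by (cases "rising (D ! k)") (auto simp: smoothed_exit_def smoothed_next_def)
  next
    case False
    then have "k \<noteq> position D v True" "k \<noteq> position D v False"
      using crossing_position[OF assms] by auto
    then show ?thesis
      using position_eqI[OF assms(1) k refl refl] False
      by (cases "rising (D ! k)") (auto simp: smoothed_exit_def smoothed_next_def out_corner_def)
  qed
  then show ?thesis
    unfolding smoothed_step_def by (intro Collect_cong ex_cong1) (auto simp del: arc_at.simps)
qed

lemma rtrancl_ascending:
  assumes "a \<le> (b::nat)" "\<And>k. a \<le> k \<Longrightarrow> k < b \<Longrightarrow> (k, Suc k) \<in> r"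
  shows "(a, b) \<in> r\<^sup>*"
  using assms
proof (induction b rule: dec_induct)
  case (step n)
  then show ?case by (meson le_imp_less_Suc less_Suc_eq rtrancl.rtrancl_into_rtrancl)
qed simp

lemma rtrancl_closed_class:
  assumes "(a, b) \<in> (r \<union> r\<inverse>)\<^sup>*" "\<And>x y. (x, y) \<in> r \<Longrightarrow> x \<in> S \<longleftrightarrow> y \<in> S"
  shows "a \<in> S \<longleftrightarrow> b \<in> S"
  using assms(1) by induction (use assms(2) in auto)

text \<open>A step of the smoothed diagram never leads into or out of the interval of arcs between the two
  passages through \<open>v\<close>. The interval is connected by steps, so it is one of the two halves, and
  the arc \<open>0\<close> lies outside it.\<close>

lemma halves:
  assumes "long_diagram D" "v \<in> vertices D"
  defines "i \<equiv> position D v True" and "j \<equiv> position D v False"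
  shows closed_half_eq: "closed_half D v = {Suc (min i j)..max i j}"
    and knot_order_eq: "knot_order D v = (if i < j then 1 else - 1)"
proof -
  define r where "r = smoothed_step D v"
  have r: "r = {(k, smoothed_next D v k) | k. k < length D}"
    using smoothed_step_eq assms by (simp add: r_def)
  have ij: "i \<noteq> j" "i < length D" "j < length D"
    using position_inj[OF assms(1,2,2)] position_less[OF assms(1,2)] by (auto simp: i_def j_def)
  have next_eq: "smoothed_next D v k = (if k = i then Suc j else if k = j then Suc i else Suc k)" for k
    by (simp add: smoothed_next_def i_def j_def)
  have L: "left_half D v = {k. (i, k) \<in> (r \<union> r\<inverse>)\<^sup>*}"
    by (simp add: left_half_def r_def i_def)
  have R: "right_half D v = {k. (Suc i, k) \<in> (r \<union> r\<inverse>)\<^sup>*}"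
    by (simp add: right_half_def r_def i_def)
  have up: "(a, b) \<in> (r \<union> r\<inverse>)\<^sup>*" if "a \<le> b" "b \<le> length D" "{a..<b} \<inter> {i, j} = {}" for a b
  proof (rule rtrancl_ascending)
    fix k assume "a \<le> k" "k < b"
    with that have "k < length D" "k \<noteq> i" "k \<noteq> j" by auto
    then show "(k, Suc k) \<in> r \<union> r\<inverse>" by (auto simp: r next_eq)
  qed (use that in simp)
  have symm: "(a, b) \<in> (r \<union> r\<inverse>)\<^sup>* \<longleftrightarrow> (b, a) \<in> (r \<union> r\<inverse>)\<^sup>*" for a b
    by (meson sym_Un_converse sym_rtrancl symD)
  let ?S = "{Suc (min i j)..max i j}"
  have S: "x \<in> ?S \<longleftrightarrow> y \<in> ?S" if "(x, y) \<in> r" for x y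
    using that ij by (auto simp: r next_eq min_def max_def split: if_splits)
  have S': "a \<in> ?S \<longleftrightarrow> b \<in> ?S" if "(a, b) \<in> (r \<union> r\<inverse>)\<^sup>*" for a b
    using rtrancl_closed_class[OF that S] .
  have inS: "(Suc (min i j), k) \<in> (r \<union> r\<inverse>)\<^sup>*" if "k \<in> ?S" for k
    by (rule up) (use that ij in \<open>auto simp: min_def max_def split: if_splits\<close>)
  have "closed_half D v = ?S \<and> knot_order D v = (if i < j then 1 else - 1)"
  proof (cases "i < j")
    case True
    have "(0, i) \<in> (r \<union> r\<inverse>)\<^sup>*" by (rule up) (use True ij in auto)
    then have "0 \<in> left_half D v" using symm L by auto
    moreover have "right_half D v = ?S"
    proof -
      have "Suc i \<in> ?S" "Suc (min i j) = Suc i" using True by auto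
      then have "(Suc i, k) \<in> (r \<union> r\<inverse>)\<^sup>* \<longleftrightarrow> k \<in> ?S" for k
        using S'[of "Suc i" k] inS[of k] by argo
      then show ?thesis by (simp only: R Collect_mem_eq)
    qed
    ultimately show ?thesis using True by (simp add: closed_half_def knot_order_def)
  next
    case False
    then have "j < i" using ij by simp
    have m: "i \<in> ?S" "0 \<notin> ?S" "Suc i \<notin> ?S" using \<open>j < i\<close> by auto
    have "left_half D v = ?S"
    proof -
      have reach: "(i, k) \<in> (r \<union> r\<inverse>)\<^sup>*" if "k \<in> ?S" for k
        using inS[OF m(1)] inS[OF that] symm[of i] by (meson rtrancl_trans)
      have "(i, k) \<in> (r \<union> r\<inverse>)\<^sup>* \<longleftrightarrow> k \<in> ?S" for k
        using S'[of i k] reach[of k] m(1) by argo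
      then show ?thesis by (simp only: L Collect_mem_eq)
    qed
    moreover have "i \<notin> right_half D v"
      unfolding R mem_Collect_eq using S'[of "Suc i" i] m by argo
    ultimately show ?thesis using m \<open>j < i\<close>
      by (auto simp: closed_half_def knot_order_def)
  qed
  then show "closed_half D v = ?S" "knot_order D v = (if i < j then 1 else - 1)"
    by simp_all
qed

text \<open>The passages strictly inside the closed half contribute their jumps, which add up to a difference
  of heights. The turn at \<open>v\<close> contributes nothing if it leads from SW to NW and
  \<open>\<gamma>(NW) - \<gamma>(SW)\<close> if it leads from SE to NE. In both cases the jump at the first passage
  through \<open>v\<close> turns the sum into the index.\<close>

theorem intersection_closed_half:
  fixes \<gamma> :: "nat \<Rightarrow> 'a::ab_group_add"
  assumes "long_diagram D" "v \<in> vertices D"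
  shows "zscale (- knot_order D v) (intersection D (closed_half_path D v) \<gamma>) = crossing_index D \<gamma> v"
proof -
  define i j where "i = position D v True" and "j = position D v False"
  have ij: "i \<noteq> j" "i < length D" "j < length D"
    using position_inj[OF assms(1,2,2)] position_less[OF assms(1,2)] by (auto simp: i_def j_def)
  have v: "crossing (D ! i) = v" "crossing (D ! j) = v" "rising (D ! i)" "\<not> rising (D ! j)"
    using crossing_position[OF assms] rising_position[OF assms] by (simp_all add: i_def j_def)
  have arc: "arc_at D v SW = i" "arc_at D v SE = j" "arc_at D v NW = Suc j" "arc_at D v NE = Suc i"
    by (simp_all add: i_def j_def)
  define contribution where "contribution k = (\<Sum>g \<in> ends_between (in_corner (D ! k)) (smoothed_exit D v k).
     if outgoing g then \<gamma> (arc_at D (crossing (D ! k)) g)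
     else - \<gamma> (arc_at D (crossing (D ! k)) g))" for k
  have inters: "intersection D (closed_half_path D v) \<gamma> = sum contribution (closed_half D v)"
  proof -
    have "closed_half_path D v = (\<lambda>k. (k, smoothed_exit D v k)) ` closed_half D v"
      by (auto simp: closed_half_path_def)
    moreover have "inj_on (\<lambda>k. (k, smoothed_exit D v k)) (closed_half D v)"
      by (auto simp: inj_on_def)
    ultimately show ?thesis
      by (simp add: intersection_def sum.reindex contribution_def)
  qed
  have term_jump: "contribution k = jump D \<gamma> (D ! k)" if "k < length D" "k \<noteq> i" "k \<noteq> j" for k
  proof -
    have "crossing (D ! k) \<noteq> v"
      using position_eqI[OF assms(1) that(1) refl refl] that(2,3)
      by (cases "rising (D ! k)") (auto simp: i_def j_def)
    then show ?thesis
      by (simp add: contribution_def smoothed_exit_def in_corner_def out_corner_def jump_def del: arc_at.simps)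
  qed
  have term_sum: "sum contribution {a..<b} = height D \<gamma> b - height D \<gamma> a"
    if "a \<le> b" "b \<le> length D" "{a..<b} \<inter> {i, j} = {}" for a b
  proof -
    have "sum contribution {a..<b} = (\<Sum>k = a..<b. jump D \<gamma> (D ! k))"
      by (rule sum.cong) (use that term_jump in auto)
    then show ?thesis using sum_jump_height that by simp
  qed
  show ?thesis
  proof (cases "i < j")
    case True
    have tj: "contribution j = \<gamma> (Suc j) - \<gamma> i"
      using v by (simp add: contribution_def smoothed_exit_def in_corner_def arc del: arc_at.simps)
    have "{Suc i..j} = insert j {Suc i..<j}" using True by auto
    then have "sum contribution (closed_half D v) = height D \<gamma> j - height D \<gamma> (Suc i) + (\<gamma> (Suc j) - \<gamma> i)"
      using term_sum[of "Suc i" j] True ij closed_half_eq[OF assms]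
      by (simp add: i_def[symmetric] j_def[symmetric] tj)
    then show ?thesis
      using True height_NE[OF assms, of \<gamma>] knot_order_eq[OF assms] inters
      by (simp add: i_def[symmetric] j_def[symmetric] crossing_index_def arc)
  next
    case False
    then have "j < i" using ij by simp
    have ti: "contribution i = 0"
      using v by (simp add: contribution_def smoothed_exit_def in_corner_def)
    have "{Suc j..i} = insert i {Suc j..<i}" using \<open>j < i\<close> by auto
    then have "sum contribution (closed_half D v) = height D \<gamma> i - height D \<gamma> (Suc j)"
      using term_sum[of "Suc j" i] \<open>j < i\<close> ij closed_half_eq[OF assms]
      by (simp add: i_def[symmetric] j_def[symmetric] ti)
    then show ?thesis
      using False height_NW[OF assms, of \<gamma>] knot_order_eq[OF assms] inters
      by (simp add: i_def[symmetric] j_def[symmetric] crossing_index_def arc)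
  qed
qed


section \<open>The potential of a dart\<close>

text \<open>Heights are measured on the left of the line. The summand \<open>\<gamma> k\<close> changes to the other side of
  the arc, so that the potential is measured on the left of the direction of travel. This makes the
  rules below the same for both directions.\<close>

fun potential :: "diagram \<Rightarrow> (nat \<Rightarrow> 'a::ab_group_add) \<Rightarrow> nat \<times> bool \<Rightarrow> 'a" where
  "potential D \<gamma> (k, f) = height D \<gamma> k + (if f then 0 else \<gamma> k)"

fun flow :: "(nat \<Rightarrow> 'a::ab_group_add) \<Rightarrow> nat \<times> bool \<Rightarrow> 'a" where
  "flow \<gamma> (k, f) = (if f then \<gamma> k else - \<gamma> k)"

context
  fixes D :: diagram and \<gamma> :: "nat \<Rightarrow> 'a::ab_group_add" and v :: nat
  assumes long: "long_diagram D" and cycle: "\<gamma> \<in> H1 D" and v: "v \<in> vertices D"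
begin

lemma cycle_at:
  "\<gamma> (arc_at D v NE) = \<gamma> (arc_at D v SW) + \<gamma> (arc_at D v SE) - \<gamma> (arc_at D v NW)"
proof -
  have "\<gamma> (arc_at D v SW) + \<gamma> (arc_at D v SE) = \<gamma> (arc_at D v NW) + \<gamma> (arc_at D v NE)"
    using cycle v unfolding H1_def by blast
  then show ?thesis by (simp del: arc_at.simps)
qed

text \<open>The sector below \<open>v\<close> gives the definition of the index. The other three sectors agree with it
  because \<open>\<gamma>\<close> is a cycle.\<close>

lemma potential_turn_left:
  "potential D \<gamma> (toward D v h) - potential D \<gamma> (away D v (clockwise h)) =
   zscale (corner_sign h) (crossing_index D \<gamma> v)"
  by (cases h) (simp_all add: height_NE[OF long v] height_NW[OF long v] cycle_at algebra_simps
      toward_def away_def corner_sign_def crossing_index_def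
      del: arc_at.simps)

text \<open>Going straight through \<open>v\<close>, the path pushed to the left meets only the end on its left, which
  is the end along which a left turn would lead.\<close>

lemma potential_straight:
  "potential D \<gamma> (away D v (clockwise (clockwise h))) =
   potential D \<gamma> (toward D v h) + flow \<gamma> (away D v (clockwise h))"
  by (cases h) (simp_all add: height_NE[OF long v] height_NW[OF long v] cycle_at algebra_simps
      toward_def away_def del: arc_at.simps)

text \<open>The cycle condition in a form that does not change when the local picture is rotated.\<close>

lemma flow_conservation:
  "flow \<gamma> (toward D v h) + flow \<gamma> (toward D v (clockwise (clockwise (clockwise h)))) =
   flow \<gamma> (away D v (clockwise h)) + flow \<gamma> (away D v (clockwise (clockwise h)))"
  by (cases h) (simp_all add: cycle_at algebra_simps toward_def away_def del: arc_at.simps)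

end

lemma flow_reverse: "flow \<gamma> (away D v h) = - flow \<gamma> (toward D v h)"
  by (simp add: toward_def away_def)


section \<open>Invariance of the index under the first two moves\<close>

lemma long_diagram_delete:
  assumes "long_diagram (u @ p @ m @ q @ w)" and "opposite ` (set p \<union> set q) \<subseteq> set p \<union> set q"
  shows "long_diagram (u @ m @ w)"
proof -
  have "opposite z \<in> set (u @ m @ w)" if z: "z \<in> set (u @ m @ w)" for z
  proof -
    have "opposite z \<in> set (u @ p @ m @ q @ w)" using assms(1) z by (auto simp: long_diagram_def)
    moreover have "opposite z \<notin> set p \<union> set q"
    proof
      assume "opposite z \<in> set p \<union> set q"
      then have "opposite (opposite z) \<in> set p \<union> set q" using assms(2) by blast
      then have "z \<in> set p \<union> set q" by simp
      moreover have "distinct (u @ p @ m @ q @ w)"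
        using assms(1) distinct_map unfolding long_diagram_def by blast
      ultimately show False using z by auto
    qed
    ultimately show ?thesis by simp
  qed
  moreover have "distinct (map (\<lambda>x. (crossing x, over x)) (u @ m @ w))"
    using assms(1) unfolding long_diagram_def by (simp add: Int_Un_distrib Int_Un_distrib2)
  ultimately show ?thesis unfolding long_diagram_def by blast
qed

lemma take_length_add: "take (length a + c) (a @ b) = a @ take c b"
  by simp

lemma crossing_index_correspond:
  assumes "\<And>h. (arc_at D v h, arc_at D' v' h) \<in> A"
    and "\<And>k k'. (k, k') \<in> A \<Longrightarrow> \<gamma> k = \<gamma>' k'"
    and "\<And>k k'. (k, k') \<in> A \<Longrightarrow> height D \<gamma> k = height D' \<gamma>' k'"
  shows "crossing_index D \<gamma> v = crossing_index D' \<gamma>' v'"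
  using assms(1)[of SW] assms(1)[of SE] assms(2)[of _ "arc_at D' v' SW"]
    assms(3)[of _ "arc_at D' v' SW"] assms(3)[of _ "arc_at D' v' SE"]
  unfolding crossing_index_def by metis

lemma jump_correspond:
  assumes "\<And>h. (arc_at D (crossing z) h, arc_at D' (crossing z') h) \<in> A"
    and "\<And>k k'. (k, k') \<in> A \<Longrightarrow> \<gamma> k = \<gamma>' k'" and "rising z = rising z'"
  shows "jump D \<gamma> z = jump D' \<gamma>' z'"
  using assms(2)[OF assms(1)] assms(3) unfolding jump_def by (simp del: arc_at.simps)

lemma arc_at_correspond:
  assumes "\<And>r. (position D v r, position D' v' r) \<in> A"
    and "\<And>r. (Suc (position D v r), Suc (position D' v' r)) \<in> A"
  shows "(arc_at D v h, arc_at D' v' h) \<in> A"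
  using assms by (cases h) auto

lemma R1_long:
  assumes "R1 D v A D'"
  shows "long_diagram D" "long_diagram D'" "v \<in> vertices D" "vertices D' \<subseteq> vertices D"
    "A \<subseteq> arcs D \<times> arcs D'"
proof -
  obtain u x w where D: "D = u @ [x, opposite x] @ w" "D' = u @ w" "v = crossing x"
    and long: "long_diagram D"
    and A: "A = {(k, k) | k. k \<le> length u} \<union> {(k + 2, k) | k. length u \<le> k \<and> k \<le> length (u @ w)}"
    using assms by (rule R1.cases) (rule that; (assumption | simp only:))
  show "long_diagram D" by fact
  show "long_diagram D'"
    using long_diagram_delete[of u "[x, opposite x]" "[]" "[]" w] long by (simp add: D)
  show "v \<in> vertices D" "vertices D' \<subseteq> vertices D" by (auto simp: D vertices_def)
  show "A \<subseteq> arcs D \<times> arcs D'" by (auto simp: D A arcs_def)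
qed

text \<open>The two passages through the removed crossing follow each other, and their jumps cancel: if the
  first one is rising, then the arcs that enter these jumps lie on both sides of the kink and
  correspond to one arc of \<open>D'\<close>; otherwise both are the loop itself. Hence heights outside the
  kink do not change.\<close>

lemma R1_index:
  fixes \<gamma> \<gamma>' :: "nat \<Rightarrow> 'a::ab_group_add"
  assumes "R1 D v A D'" and \<gamma>: "\<And>k k'. (k, k') \<in> A \<Longrightarrow> \<gamma> k = \<gamma>' k'"
  shows R1_index_removed: "crossing_index D \<gamma> v = 0"
    and R1_index_survives: "\<And>t. t \<in> vertices D' \<Longrightarrow> crossing_index D \<gamma> t = crossing_index D' \<gamma>' t"
proof -
  obtain u x w where D: "D = u @ [x, opposite x] @ w" "D' = u @ w" "v = crossing x"
    and long: "long_diagram D"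
    and A: "A = {(k, k) | k. k \<le> length u} \<union> {(k + 2, k) | k. length u \<le> k \<and> k \<le> length (u @ w)}"
    using assms(1) by (rule R1.cases) (rule that; (assumption | simp only:))
  have long': "long_diagram D'" using R1_long(2)[OF assms(1)] .
  have \<gamma>u: "\<gamma> (length u) = \<gamma> (length u + 2)"
    using \<gamma>[of "length u" "length u"] \<gamma>[of "length u + 2" "length u"] by (simp add: A)
  have pos: "position D v (rising x) = length u" "position D v (\<not> rising x) = Suc (length u)"
    by (rule position_eqI[OF long]; simp add: D nth_append)+
  then have posx: "position D v True = (if rising x then length u else Suc (length u))"
    "position D v False = (if rising x then Suc (length u) else length u)"
    by (auto split: if_splits)
  have arc: "(arc_at D t h, arc_at D' t h) \<in> A" if t: "t \<in> vertices D'" for t h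
  proof (rule arc_at_correspond)
    fix r
    define q where "q = position D' t r"
    have q: "q < length D'" "crossing (D' ! q) = t" "rising (D' ! q) = r"
      using position[OF long' t] by (simp_all add: q_def)
    have "position D t r = (if q < length u then q else q + 2)"
      by (rule position_eqI[OF long]) (use q in \<open>auto simp: D nth_append nth_Cons' split: if_splits\<close>)
    moreover have "length D' = length u + length w" by (simp add: D)
    ultimately show "(position D t r, position D' t r) \<in> A"
        "(Suc (position D t r), Suc (position D' t r)) \<in> A"
      unfolding q_def[symmetric] using q(1) by (auto simp: A)
  qed
  have jump: "jump D \<gamma> z = jump D' \<gamma>' z" if "z \<in> set D'" for z
    using that by (intro jump_correspond[OF arc \<gamma>]) (auto simp: vertices_def)
  have jumps: "sum_list (map (jump D \<gamma>) l) = sum_list (map (jump D' \<gamma>') l)"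
    if "set l \<subseteq> set D'" for l
    using jump that by (intro arg_cong[where f = sum_list] map_cong) auto
  have cancel: "jump D \<gamma> x + jump D \<gamma> (opposite x) = 0"
    using \<gamma>u by (simp add: jump_def D(3)[symmetric] posx)
  have height: "height D \<gamma> k = height D' \<gamma>' k'" if "(k, k') \<in> A" for k k'
  proof -
    consider "k' = k" "k \<le> length u" | "k = k' + 2" "length u \<le> k'" using \<open>(k, k') \<in> A\<close> by (auto simp: A)
    then show ?thesis
    proof cases
      case 1
      then have "take k D = take k u" "take k' D' = take k u" by (simp_all add: D)
      moreover have "set (take k u) \<subseteq> set D'" using set_take_subset[of k u] by (auto simp: D)
      ultimately show ?thesis using jumps by (simp add: height_def)
    next
      case 2
      have "take k D = u @ [x, opposite x] @ take (k' - length u) w" "take k' D' = u @ take (k' - length u) w"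
        using 2 by (simp_all add: D Suc_diff_le)
      moreover have "set u \<subseteq> set D'" "set (take (k' - length u) w) \<subseteq> set D'"
        using set_take_subset[of "k' - length u" w] by (auto simp: D)
      ultimately show ?thesis using jumps cancel by (simp add: height_def add.assoc[symmetric])
    qed
  qed
  show "crossing_index D \<gamma> t = crossing_index D' \<gamma>' t" if "t \<in> vertices D'" for t
    using crossing_index_correspond[OF arc[OF that] \<gamma> height] by blast
  have "height D \<gamma> (Suc (length u)) = height D \<gamma> (length u) + jump D \<gamma> x"
    using height_Suc[of "length u" D \<gamma>] by (simp add: D nth_append)
  then show "crossing_index D \<gamma> v = 0"
    using \<gamma>u by (simp add: crossing_index_def jump_def D(3)[symmetric] posx)
qed

lemma R2_long:
  assumes "R2 D v v' A D'"
  shows "long_diagram D" "long_diagram D'" "v \<in> vertices D" "v' \<in> vertices D"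
    "vertices D' \<subseteq> vertices D" "A \<subseteq> arcs D \<times> arcs D'"
proof -
  obtain u x y m q w where D: "D = u @ [x, y] @ m @ q @ w" "D' = u @ m @ w" "v = crossing x" "v' = crossing y"
    and long: "long_diagram D"
    and q: "q = [opposite x, opposite y] \<or> q = [opposite y, opposite x]"
    and A: "A = {(k, k) | k. k \<le> length u} \<union> {(k + 2, k) | k. length u \<le> k \<and> k \<le> length (u @ m)} \<union>
       {(k + 4, k) | k. length (u @ m) \<le> k \<and> k \<le> length (u @ m @ w)}"
    using assms by (rule R2.cases) (rule that; (assumption | simp only:))
  have "length q = 2" using q by auto
  show "long_diagram D" by fact
  show "long_diagram D'"
    using long_diagram_delete[of u "[x, y]" m q w] long q by (auto simp: D)
  show "v \<in> vertices D" "v' \<in> vertices D" "vertices D' \<subseteq> vertices D" by (auto simp: D vertices_def)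
  show "A \<subseteq> arcs D \<times> arcs D'" using \<open>length q = 2\<close> by (auto simp: D A arcs_def)
qed

text \<open>Each of the two strands passes the removed crossings one after the other, once rising and once
  falling. The arcs of the other strand that enter the two jumps are both the inner arc of the
  bigon, or both outside and correspondent to one arc of \<open>D'\<close>. So the jumps cancel and heights
  outside the bigon do not change.\<close>

lemma R2_index:
  fixes \<gamma> \<gamma>' :: "nat \<Rightarrow> 'a::ab_group_add"
  assumes "R2 D v v' A D'" and \<gamma>: "\<And>k k'. (k, k') \<in> A \<Longrightarrow> \<gamma> k = \<gamma>' k'"
  shows R2_index_removed: "crossing_index D \<gamma> v + crossing_index D \<gamma> v' = 0"
    and R2_index_survives: "\<And>t. t \<in> vertices D' \<Longrightarrow> crossing_index D \<gamma> t = crossing_index D' \<gamma>' t"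
proof -
  obtain u x y m q w where D: "D = u @ [x, y] @ m @ q @ w" "D' = u @ m @ w" "v = crossing x" "v' = crossing y"
    and long: "long_diagram D" and xy: "over x = over y" "positive x \<noteq> positive y"
    and q: "q = [opposite x, opposite y] \<or> q = [opposite y, opposite x]"
    and A: "A = {(k, k) | k. k \<le> length u} \<union> {(k + 2, k) | k. length u \<le> k \<and> k \<le> length (u @ m)} \<union>
       {(k + 4, k) | k. length (u @ m) \<le> k \<and> k \<le> length (u @ m @ w)}"
    using assms(1) by (rule R2.cases) (rule that; (assumption | simp only:))
  define X M where "X = length u" and "M = length u + 2 + length m"
  have lq: "length q = 2" using q by auto
  have ry: "rising y \<longleftrightarrow> \<not> rising x" using xy by (auto simp: rising_def)
  have long': "long_diagram D'" using R2_long(2)[OF assms(1)] .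
  have \<gamma>X: "\<gamma> X = \<gamma> (Suc (Suc X))"
    using \<gamma>[of "length u" "length u"] \<gamma>[of "length u + 2" "length u"] by (simp add: A X_def)
  have \<gamma>M: "\<gamma> M = \<gamma> (Suc (Suc M))"
    using \<gamma>[of "M" "length (u @ m)"] \<gamma>[of "M + 2" "length (u @ m)"] by (simp add: A M_def)
  have nths: "D ! X = x" "D ! Suc X = y" "D ! M = q ! 0" "D ! Suc M = q ! 1"
    using lq by (simp_all add: D X_def M_def nth_append)
  have lens: "X < length D" "Suc X < length D" "M < length D" "Suc M < length D"
    using lq by (simp_all add: D X_def M_def)
  have posx: "position D v (rising x) = X" "position D v' (\<not> rising x) = Suc X"
    by (rule position_eqI[OF long]; simp add: nths lens D(3,4) ry)+
  have pos_par: "position D v (\<not> rising x) = M" "position D v' (rising x) = Suc M"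
    if "q = [opposite x, opposite y]"
    by (rule position_eqI[OF long]; simp add: nths lens D(3,4) ry that)+
  have pos_anti: "position D v (\<not> rising x) = Suc M" "position D v' (rising x) = M"
    if "q = [opposite y, opposite x]"
    by (rule position_eqI[OF long]; simp add: nths lens D(3,4) ry that)+
  have arc: "(arc_at D t h, arc_at D' t h) \<in> A" if t: "t \<in> vertices D'" for t h
  proof (rule arc_at_correspond)
    fix r
    define k where "k = position D' t r"
    have k: "k < length D'" "crossing (D' ! k) = t" "rising (D' ! k) = r"
      using position[OF long' t] by (simp_all add: k_def)
    define l where "l = (if k < length u then k else if k < length (u @ m) then k + 2 else k + 4)"
    have "l < length D" using k(1) lq by (simp add: D l_def)
    moreover have "D ! l = D' ! k"
    proof -
      consider "k < length u" | "length u \<le> k" "k < length (u @ m)" | "length (u @ m) \<le> k" by linarith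
      then show ?thesis
      proof cases
        case 1
        then show ?thesis by (simp add: l_def D nth_append)
      next
        case 2
        then obtain c where "k = length u + c" "c < length m" by (auto simp: le_iff_add)
        then show ?thesis by (simp add: l_def D nth_append)
      next
        case 3
        then obtain c where "k = length u + length m + c" by (auto simp: le_iff_add)
        then show ?thesis using lq by (simp add: l_def D nth_append)
      qed
    qed
    ultimately have "position D t r = l" using position_eqI[OF long] k by simp
    moreover have "length D' = length u + length m + length w" by (simp add: D)
    ultimately show "(position D t r, position D' t r) \<in> A"
        "(Suc (position D t r), Suc (position D' t r)) \<in> A"
      unfolding k_def[symmetric] using k(1) by (auto simp: A l_def)
  qed
  have jump: "jump D \<gamma> z = jump D' \<gamma>' z" if "z \<in> set D'" for z
    using that by (intro jump_correspond[OF arc \<gamma>]) (auto simp: vertices_def)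
  have jumps: "sum_list (map (jump D \<gamma>) l) = sum_list (map (jump D' \<gamma>') l)"
    if "set l \<subseteq> set D'" for l
    using jump that by (intro arg_cong[where f = sum_list] map_cong) auto
  have cancel: "jump D \<gamma> x + jump D \<gamma> y = 0"
    using q
  proof
    assume "q = [opposite x, opposite y]"
    then show ?thesis using posx pos_par \<gamma>M
      by (cases "rising x") (simp_all add: jump_def ry flip: D(3,4))
  next
    assume "q = [opposite y, opposite x]"
    then show ?thesis using posx pos_anti \<gamma>M
      by (cases "rising x") (simp_all add: jump_def ry flip: D(3,4))
  qed
  have cancelq: "jump D \<gamma> (q ! 0) + jump D \<gamma> (q ! 1) = 0"
    using q
  proof
    assume "q = [opposite x, opposite y]"
    then show ?thesis using posx pos_par \<gamma>X
      by (cases "rising x") (simp_all add: jump_def ry flip: D(3,4))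
  next
    assume "q = [opposite y, opposite x]"
    then show ?thesis using posx pos_anti \<gamma>X
      by (cases "rising x") (simp_all add: jump_def ry flip: D(3,4))
  qed
  have sum_q: "sum_list (map (jump D \<gamma>) q) = 0"
    using cancelq q by auto
  have height: "height D \<gamma> k = height D' \<gamma>' k'" if "(k, k') \<in> A" for k k'
  proof -
    consider "k' = k" "k \<le> length u" | "k = k' + 2" "length u \<le> k'" "k' \<le> length (u @ m)"
      | "k = k' + 4" "length (u @ m) \<le> k'" using \<open>(k, k') \<in> A\<close> by (auto simp: A)
    then show ?thesis
    proof cases
      case 1
      then have "take k D = take k u" "take k' D' = take k u" by (simp_all add: D)
      moreover have "set (take k u) \<subseteq> set D'" using set_take_subset[of k u] by (auto simp: D)
      ultimately show ?thesis using jumps by (simp add: height_def)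
    next
      case 2
      have "take k D = u @ [x, y] @ take (k' - length u) m" "take k' D' = u @ take (k' - length u) m"
        using 2 by (simp_all add: D Suc_diff_le)
      moreover have "set u \<subseteq> set D'" "set (take (k' - length u) m) \<subseteq> set D'"
        using set_take_subset[of "k' - length u" m] by (auto simp: D)
      ultimately show ?thesis using jumps cancel by (simp add: height_def add.assoc[symmetric])
    next
      case 3
      then obtain c where c: "k' = length u + length m + c" by (auto simp: le_iff_add)
      have "D = (u @ [x, y] @ m @ q) @ w" "k = length (u @ [x, y] @ m @ q) + c"
        using 3 lq by (simp_all add: D c)
      then have "take k D = (u @ [x, y] @ m @ q) @ take c w"
        by (simp only: take_length_add)
      moreover have "take k' D' = u @ m @ take c w" by (simp add: D c)
      moreover have "set u \<subseteq> set D'" "set m \<subseteq> set D'" "set (take c w) \<subseteq> set D'"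
        using set_take_subset[of c w] by (auto simp: D)
      ultimately show ?thesis using jumps cancel sum_q
        by (simp add: height_def add.assoc[symmetric])
    qed
  qed
  show "crossing_index D \<gamma> t = crossing_index D' \<gamma>' t" if "t \<in> vertices D'" for t
    using crossing_index_correspond[OF arc[OF that] \<gamma> height] by blast
  have hX: "height D \<gamma> (Suc X) = height D \<gamma> X + jump D \<gamma> x"
    and hM: "height D \<gamma> (Suc M) = height D \<gamma> M + jump D \<gamma> (q ! 0)"
    using height_Suc[of X D \<gamma>] height_Suc[of M D \<gamma>] lens nths by simp_all
  show "crossing_index D \<gamma> v + crossing_index D \<gamma> v' = 0"
    using q
  proof
    assume "q = [opposite x, opposite y]"
    then show ?thesis using posx pos_par \<gamma>X \<gamma>M hX hM
      by (cases "rising x") (simp_all add: crossing_index_def jump_def ry flip: D(3,4))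
  next
    assume "q = [opposite y, opposite x]"
    then show ?thesis using posx pos_anti \<gamma>X \<gamma>M hX hM
      by (cases "rising x") (simp_all add: crossing_index_def jump_def ry flip: D(3,4))
  qed
qed


section \<open>Invariance of the index under the third move\<close>

text \<open>The exchange of \<open>k - 1\<close> and \<open>k\<close> for all \<open>k \<in> S\<close>, meant for sets of positive
  numbers without neighbours.\<close>

definition flip :: "nat set \<Rightarrow> nat \<Rightarrow> nat" where
  "flip S q = (if q \<in> S then q - 1 else if Suc q \<in> S then Suc q else q)"

definition seat :: "diagram \<Rightarrow> nat \<Rightarrow> corner \<Rightarrow> nat" where
  "seat D v h = position D v (strand h)"

lemma arc_at_seat: "arc_at D v h = (if outgoing h then Suc (seat D v h) else seat D v h)"
  by (cases h) (auto simp: seat_def strand_def)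

lemma seat_clockwise2 [simp]: "seat D v (clockwise (clockwise h)) = seat D v h"
  by (simp add: seat_def)

text \<open>The boundary walk of the triangle reaches \<open>v1\<close>, \<open>v2\<close> and \<open>v3\<close> at the ends \<open>h1\<close>,
  \<open>h2\<close> and \<open>h3\<close>, and a side is named after the crossing that it leads to. The assumptions are
  invariant under cyclic rotation, so a fact about one side or vertex is proved once, and the
  context is closed before the fact is used for the rotated triangle.\<close>

locale triangle_face =
  fixes D :: diagram and v1 v2 v3 :: nat and h1 h2 h3 :: corner
  assumes long: "long_diagram D"
    and vertices: "v1 \<in> vertices D" "v2 \<in> vertices D" "v3 \<in> vertices D"
    and distinct: "v1 \<noteq> v2" "v2 \<noteq> v3" "v3 \<noteq> v1"
    and side1: "away D v3 (clockwise h3) = toward D v1 h1"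
    and side2: "away D v1 (clockwise h1) = toward D v2 h2"
    and side3: "away D v2 (clockwise h2) = toward D v3 h3"
begin

abbreviation "sides \<equiv> {arc_at D v1 h1, arc_at D v2 h2, arc_at D v3 h3}"

lemma rotate_face: "triangle_face D v2 v3 v1 h2 h3 h1"
  by unfold_locales (use long vertices distinct side1 side2 side3 in auto)

lemma side_seats:
  "outgoing h1 \<longleftrightarrow> \<not> outgoing (clockwise h3)"
  "arc_at D v1 h1 = (if outgoing h1 then Suc (seat D v1 h1) else seat D v1 h1)"
  "arc_at D v1 h1 = (if outgoing h1 then seat D v3 (clockwise h3) else Suc (seat D v3 (clockwise h3)))"
proof -
  show 1: "outgoing h1 \<longleftrightarrow> \<not> outgoing (clockwise h3)"
    using side1 by (simp add: away_def toward_def)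
  show "arc_at D v1 h1 = (if outgoing h1 then Suc (seat D v1 h1) else seat D v1 h1)"
    by (rule arc_at_seat)
  have "arc_at D v1 h1 = arc_at D v3 (clockwise h3)"
    using side1 by (simp add: away_def toward_def)
  then show "arc_at D v1 h1 = (if outgoing h1 then seat D v3 (clockwise h3) else Suc (seat D v3 (clockwise h3)))"
    using 1 arc_at_seat[of D v3 "clockwise h3"] by simp
qed

lemma side_seats_cases:
  "seat D v1 h1 = arc_at D v1 h1 - 1 \<and> seat D v3 (clockwise h3) = arc_at D v1 h1 \<or>
   seat D v1 h1 = arc_at D v1 h1 \<and> seat D v3 (clockwise h3) = arc_at D v1 h1 - 1"
  using side_seats(2,3) by (metis diff_Suc_1)

lemma side_pos: "0 < arc_at D v1 h1" "arc_at D v1 h1 < length D"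
proof -
  have "seat D v1 h1 < length D" "seat D v3 (clockwise h3) < length D"
    using position_less[OF long] vertices by (simp_all add: seat_def)
  then show "0 < arc_at D v1 h1" "arc_at D v1 h1 < length D"
    using side_seats(2,3) by (metis zero_less_Suc)+
qed

text \<open>The walk changes the strand at every vertex. So each of the six passages through the three
  vertices is an end point of exactly one side.\<close>

lemma side_neighbours:
  "arc_at D v1 h1 \<noteq> arc_at D v2 h2"
  "Suc (arc_at D v1 h1) \<noteq> arc_at D v2 h2" "arc_at D v1 h1 \<noteq> Suc (arc_at D v2 h2)"
proof -
  interpret r2: triangle_face D v2 v3 v1 h2 h3 h1 by (rule rotate_face)
  define T where "T k = (crossing (D ! k), rising (D ! k))" for k
  have T: "T (seat D v h) = (v, strand h)" if "v \<in> vertices D" for v h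
    using position[OF long that] by (simp add: T_def seat_def)
  define k l where "k = arc_at D v1 h1" and "l = arc_at D v2 h2"
  have "T ` {k, k - 1} = {T (seat D v1 h1), T (seat D v3 (clockwise h3))}"
    using side_seats_cases unfolding k_def[symmetric] by (elim disjE conjE) (simp_all add: insert_commute)
  then have 1: "T ` {k, k - 1} = {(v1, strand h1), (v3, \<not> strand h3)}"
    unfolding T[OF vertices(1)] T[OF vertices(3)] by simp
  have "T ` {l, l - 1} = {T (seat D v2 h2), T (seat D v1 (clockwise h1))}"
    using r2.side_seats_cases unfolding l_def[symmetric] by (elim disjE conjE) (simp_all add: insert_commute)
  then have 2: "T ` {l, l - 1} = {(v2, strand h2), (v1, \<not> strand h1)}"
    unfolding T[OF vertices(1)] T[OF vertices(2)] by simp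
  have "T ` {k, k - 1} \<inter> T ` {l, l - 1} = {}"
    unfolding 1 2 using distinct by auto
  then have "k \<noteq> l" "Suc k \<noteq> l" "k \<noteq> Suc l" by auto
  then show "arc_at D v1 h1 \<noteq> arc_at D v2 h2"
    "Suc (arc_at D v1 h1) \<noteq> arc_at D v2 h2" "arc_at D v1 h1 \<noteq> Suc (arc_at D v2 h2)"
    by (simp_all add: k_def l_def)
qed

end

context triangle_face
begin

interpretation r2: triangle_face D v2 v3 v1 h2 h3 h1 by (rule rotate_face)
interpretation r3: triangle_face D v3 v1 v2 h3 h1 h2 by (rule r2.rotate_face)

lemma sides_pos: "k \<in> sides \<Longrightarrow> 0 < k \<and> k < length D"
  using side_pos r2.side_pos r3.side_pos by auto

lemma sides_not_adjacent:
  assumes "k \<in> sides"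
  shows "Suc k \<notin> sides" "k - 1 \<notin> sides"
proof -
  have *: "Suc l \<notin> sides" if "l \<in> sides" for l
    using that side_neighbours r2.side_neighbours r3.side_neighbours
    by (metis insertE singletonD n_not_Suc_n)
  then show "Suc k \<notin> sides" using assms .
  show "k - 1 \<notin> sides" using *[of "k - 1"] sides_pos[OF assms] assms by (metis Suc_pred')
qed

end

locale triangle_flip = triangle_face D v1 v2 v3 h1 h2 h3
  for D D' :: diagram and v1 v2 v3 :: nat and h1 h2 h3 :: corner +
  assumes long': "long_diagram D'" and len: "length D' = length D"
    and nth': "\<And>q. q < length D \<Longrightarrow> D' ! q = D ! flip sides q"
begin

lemma rotate: "triangle_flip D D' v2 v3 v1 h2 h3 h1"
proof -
  interpret r2: triangle_face D v2 v3 v1 h2 h3 h1 by (rule rotate_face)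
  show ?thesis by unfold_locales (use long' len nth' in \<open>simp_all add: insert_commute\<close>)
qed

lemma flip_simps:
  "k \<in> sides \<Longrightarrow> flip sides k = k - 1" "k \<in> sides \<Longrightarrow> flip sides (k - 1) = k"
  using sides_not_adjacent sides_pos by (auto simp: flip_def)

lemma flip_flip: "flip sides (flip sides q) = q"
  using sides_not_adjacent[of q] sides_not_adjacent[of "Suc q"] sides_pos[of q]
  unfolding flip_def by (auto simp del: insert_iff)

lemma flip_less: "q < length D \<Longrightarrow> flip sides q < length D"
  using sides_pos[of "Suc q"] unfolding flip_def by (auto simp del: insert_iff)

lemma vertices_eq: "vertices D' = vertices D"
proof -
  have "set D' = set D"
  proof
    show "set D' \<subseteq> set D" using nth' flip_less len by (fastforce simp: in_set_conv_nth)
    have "D ! q \<in> set D'" if "q < length D" for q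
      using nth'[OF flip_less[OF that]] flip_flip flip_less[OF that] len
      by (metis nth_mem)
    then show "set D \<subseteq> set D'" by (auto simp: in_set_conv_nth)
  qed
  then show ?thesis by (simp add: vertices_def)
qed

lemma position': "v \<in> vertices D \<Longrightarrow> position D' v r = flip sides (position D v r)"
  using position[OF long, of v r] nth'[OF flip_less] flip_flip flip_less len
  by (intro position_eqI[OF long']) auto

lemma seat': "v \<in> vertices D \<Longrightarrow> seat D' v h = flip sides (seat D v h)"
  unfolding seat_def by (rule position')

lemma seats':
  "seat D' v1 h1 = seat D v3 (clockwise h3)" "seat D' v3 (clockwise h3) = seat D v1 h1"
  unfolding seat'[OF vertices(1)] seat'[OF vertices(3)]
  using flip_simps[of "arc_at D v1 h1"] side_seats_cases by (elim disjE conjE; simp)+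

text \<open>On every strand the two crossings change places. At each vertex, therefore, the ends that bounded
  the triangle become outer ends, and conversely.\<close>

lemma darts':
  "toward D' v1 h1 = toward D v3 (clockwise (clockwise (clockwise h3)))"
  "away D' v3 (clockwise h3) = away D v1 (clockwise (clockwise h1))"
  "away D' v1 (clockwise (clockwise h1)) = toward D v1 h1"
  "toward D' v3 (clockwise (clockwise (clockwise h3))) = toward D v1 h1"
proof -
  show "toward D' v1 h1 = toward D v3 (clockwise (clockwise (clockwise h3)))"
    "away D' v3 (clockwise h3) = away D v1 (clockwise (clockwise h1))"
    using side_seats(1) by (simp_all add: toward_def away_def arc_at_seat seats')
  show "away D' v1 (clockwise (clockwise h1)) = toward D v1 h1"
    using side_seats(3) by (simp add: toward_def away_def arc_at_seat[of D'] seats')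
  show "toward D' v3 (clockwise (clockwise (clockwise h3))) = toward D v1 h1"
    using side_seats(1,2) by (simp add: toward_def away_def arc_at_seat[of D'] seats')
qed

lemma outer:
  "fst (toward D v3 (clockwise (clockwise (clockwise h3)))) \<in> arcs D - sides"
  "fst (away D v1 (clockwise (clockwise h1))) \<in> arcs D - sides"
proof -
  let ?k = "arc_at D v1 h1"
  have "arc_at D v3 (clockwise (clockwise (clockwise h3))) = (if outgoing h1 then Suc ?k else ?k - 1)"
    using side_seats(1,3) arc_at_seat[of D v3 "clockwise (clockwise (clockwise h3))"] by simp
  moreover have "arc_at D v1 (clockwise (clockwise h1)) = (if outgoing h1 then ?k - 1 else Suc ?k)"
    using side_seats(1,2) arc_at_seat[of D v1 "clockwise (clockwise h1)"] by simp
  ultimately have "arc_at D v3 (clockwise (clockwise (clockwise h3))) \<notin> sides"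
    "arc_at D v1 (clockwise (clockwise h1)) \<notin> sides"
    using sides_not_adjacent[of ?k] by (simp_all del: insert_iff add: insertI1)
  then show "fst (toward D v3 (clockwise (clockwise (clockwise h3)))) \<in> arcs D - sides"
    "fst (away D v1 (clockwise (clockwise h1))) \<in> arcs D - sides"
    using arc_at_in_arcs[OF long] vertices by (simp_all add: toward_def away_def)
qed

end

lemma potential_cong:
  "\<gamma> (fst d) = \<gamma>' (fst d) \<Longrightarrow> height D \<gamma> (fst d) = height D' \<gamma>' (fst d) \<Longrightarrow>
   potential D \<gamma> d = potential D' \<gamma>' d"
  by (cases d) auto

lemma flow_cong: "\<gamma> (fst d) = \<gamma>' (fst d) \<Longrightarrow> flow \<gamma> d = flow \<gamma>' d"
  by (cases d) auto

context triangle_flip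
begin

interpretation r2: triangle_flip D D' v2 v3 v1 h2 h3 h1 by (rule rotate)

lemma side_crossings:
  "crossing (D ! arc_at D v1 h1) \<in> {v1, v3}" "crossing (D ! (arc_at D v1 h1 - 1)) \<in> {v1, v3}"
proof -
  have "crossing (D ! seat D v1 h1) = v1" "crossing (D ! seat D v3 (clockwise h3)) = v3"
    using crossing_position[OF long] vertices by (simp_all add: seat_def)
  then show "crossing (D ! arc_at D v1 h1) \<in> {v1, v3}" "crossing (D ! (arc_at D v1 h1 - 1)) \<in> {v1, v3}"
    using side_seats_cases by (metis insertI1 insertI2)+
qed

lemma position_flipped: "position D v1 r \<in> sides \<or> Suc (position D v1 r) \<in> sides"
proof -
  have "seat D v1 h1 \<in> sides \<or> Suc (seat D v1 h1) \<in> sides"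
    using side_seats(2) by (metis insertI1)
  moreover have "seat D v1 (clockwise h1) \<in> sides \<or> Suc (seat D v1 (clockwise h1)) \<in> sides"
    using r2.side_seats(3) by (metis insertI1 insertI2)
  ultimately show ?thesis unfolding seat_def clockwise_simps(3)
    by (cases "r = strand h1") (simp_all del: insert_iff)
qed

end

context triangle_flip
begin

interpretation r2: triangle_flip D D' v2 v3 v1 h2 h3 h1 by (rule rotate)
interpretation r3: triangle_flip D D' v3 v1 v2 h3 h1 h2 by (rule r2.rotate)

lemma flipped_iff:
  assumes "q < length D"
  shows "q \<in> sides \<or> Suc q \<in> sides \<longleftrightarrow> crossing (D ! q) \<in> {v1, v2, v3}"
proof
  have c: "crossing (D ! k) \<in> {v1, v2, v3} \<and> crossing (D ! (k - 1)) \<in> {v1, v2, v3}" if "k \<in> sides" for k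
    using that side_crossings r2.side_crossings r3.side_crossings
    unfolding insert_iff empty_iff by (elim disjE[of "k = _"]; simp; argo)
  assume "q \<in> sides \<or> Suc q \<in> sides"
  then show "crossing (D ! q) \<in> {v1, v2, v3}"
    using c[of q] c[of "Suc q"] by (elim disjE) (simp_all del: insert_iff)
next
  assume "crossing (D ! q) \<in> {v1, v2, v3}"
  moreover have "position D v r \<in> sides \<or> Suc (position D v r) \<in> sides" if "v \<in> {v1, v2, v3}" for v r
    using that position_flipped[of r] r2.position_flipped[of r] r3.position_flipped[of r]
    unfolding insert_iff empty_iff by (elim disjE; blast)
  ultimately show "q \<in> sides \<or> Suc q \<in> sides"
    using position_eqI[OF long assms refl refl] by metis
qed

lemma arcs_other:
  assumes "v \<in> vertices D" "v \<notin> {v1, v2, v3}"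
  shows "arc_at D' v h = arc_at D v h" "arc_at D v h \<in> arcs D - sides"
proof -
  have 1: "position D v r \<notin> sides" "Suc (position D v r) \<notin> sides" for r
    using flipped_iff[OF position_less[OF long assms(1)]] crossing_position[OF long assms(1)] assms(2)
    by auto
  then have "position D' v r = position D v r" for r
    using position'[OF assms(1)] by (simp add: flip_def)
  then show "arc_at D' v h = arc_at D v h" by (cases h) auto
  have "arc_at D v h \<notin> sides" using 1 by (cases h) (simp_all del: insert_iff)
  then show "arc_at D v h \<in> arcs D - sides"
    using arc_at_in_arcs[OF long assms(1)] by blast
qed

end

lemma exchange_summands:
  fixes a b c d :: "'a::ab_group_add"
  assumes "a + b = c + d"
  shows "d - b = a - c"
proof -
  have "d = a + b - c" by (simp add: assms)
  then show ?thesis by (simp add: algebra_simps)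
qed

text \<open>Invariance of the cycle under the third move is only known outside the sides of the triangle.\<close>

locale triangle_flip_cycles = triangle_flip D D' v1 v2 v3 h1 h2 h3
  for D D' v1 v2 v3 h1 h2 h3 +
  fixes \<gamma> \<gamma>' :: "nat \<Rightarrow> 'a::ab_group_add"
  assumes cycle: "\<gamma> \<in> H1 D" and cycle': "\<gamma>' \<in> H1 D'"
    and agree: "\<And>k. k \<in> arcs D - sides \<Longrightarrow> \<gamma> k = \<gamma>' k"
begin

lemma rotate_cycles: "triangle_flip_cycles D D' v2 v3 v1 h2 h3 h1 \<gamma> \<gamma>'"
proof -
  interpret r2: triangle_flip D D' v2 v3 v1 h2 h3 h1 by (rule rotate)
  show ?thesis by unfold_locales (use cycle cycle' agree in \<open>auto simp: insert_commute\<close>)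
qed

lemmas straight = potential_straight[OF long cycle]
lemmas straight' = potential_straight[OF long' cycle', unfolded vertices_eq]

lemma side_potential:
  "potential D \<gamma> (toward D v1 h1) =
   potential D \<gamma> (toward D v3 (clockwise (clockwise (clockwise h3)))) - flow \<gamma> (toward D v3 h3)"
  "potential D \<gamma> (away D v1 (clockwise (clockwise h1))) =
   potential D \<gamma> (toward D v1 h1) + flow \<gamma> (toward D v2 h2)"
  using straight[OF vertices(3), of "clockwise (clockwise (clockwise h3))"]
    straight[OF vertices(1), of h1]
  by (simp_all add: side1 side2 flow_reverse del: potential.simps flow.simps)

text \<open>The strand of the first side crosses the other two strands. The change of the potential is
  determined by the ends on the left of the strand; before the move these are sides of the triangle,
  after the move they are outer ends. The two changes agree by the cycle condition at \<open>v2\<close>,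
  where the other two strands cross.\<close>

lemma potential_across:
  "potential D' \<gamma>' (away D v1 (clockwise (clockwise h1))) -
   potential D' \<gamma>' (toward D v3 (clockwise (clockwise (clockwise h3)))) =
   potential D \<gamma> (away D v1 (clockwise (clockwise h1))) -
   potential D \<gamma> (toward D v3 (clockwise (clockwise (clockwise h3))))"
proof -
  interpret r2: triangle_flip D D' v2 v3 v1 h2 h3 h1 by (rule rotate)
  interpret r3: triangle_flip D D' v3 v1 v2 h3 h1 h2 by (rule r2.rotate)
  have "potential D' \<gamma>' (toward D v1 h1) =
      potential D' \<gamma>' (toward D v3 (clockwise (clockwise (clockwise h3)))) +
      flow \<gamma>' (away D v2 (clockwise (clockwise h2)))"
    using straight'[OF vertices(1), of h1] darts' r2.darts' by simp
  moreover have "potential D' \<gamma>' (away D v1 (clockwise (clockwise h1))) =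
      potential D' \<gamma>' (toward D v1 h1) -
      flow \<gamma>' (toward D v2 (clockwise (clockwise (clockwise h2))))"
    using straight'[OF vertices(3), of "clockwise (clockwise (clockwise h3))"] darts' r3.darts'
    by (simp add: flow_reverse)
  moreover have "flow \<gamma>' (away D v2 (clockwise (clockwise h2))) = flow \<gamma> (away D v2 (clockwise (clockwise h2)))"
    using r2.outer agree by (intro flow_cong) (auto simp: insert_commute)
  moreover have "flow \<gamma>' (toward D v2 (clockwise (clockwise (clockwise h2)))) =
      flow \<gamma> (toward D v2 (clockwise (clockwise (clockwise h2))))"
    using r3.outer agree by (intro flow_cong) (auto simp: insert_commute)
  moreover have "flow \<gamma> (toward D v2 h2) + flow \<gamma> (toward D v2 (clockwise (clockwise (clockwise h2)))) =
      flow \<gamma> (toward D v3 h3) + flow \<gamma> (away D v2 (clockwise (clockwise h2)))"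
    using flow_conservation[OF long cycle vertices(2), of h2] side3 by simp
  ultimately have
    "potential D' \<gamma>' (away D v1 (clockwise (clockwise h1))) -
     potential D' \<gamma>' (toward D v3 (clockwise (clockwise (clockwise h3)))) =
     flow \<gamma> (toward D v2 h2) - flow \<gamma> (toward D v3 h3)"
    using exchange_summands by simp
  then show ?thesis
    using side_potential by simp
qed

lemma height_across:
  assumes "k = arc_at D v1 h1"
  shows "height D' \<gamma>' (Suc k) - height D' \<gamma>' (k - 1) = height D \<gamma> (Suc k) - height D \<gamma> (k - 1)"
proof -
  have "0 < k" using side_pos assms by simp
  show ?thesis
  proof (cases "outgoing h1")
    case True
    then have "away D v1 (clockwise (clockwise h1)) = (k - 1, False)"
      "toward D v3 (clockwise (clockwise (clockwise h3))) = (Suc k, False)"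
      using side_seats assms by (simp_all add: toward_def away_def arc_at_seat)
    moreover from this have "\<gamma> (k - 1) = \<gamma>' (k - 1)" "\<gamma> (Suc k) = \<gamma>' (Suc k)"
      using outer agree by (metis fst_conv)+
    ultimately show ?thesis using potential_across by (simp add: algebra_simps)
  next
    case False
    then have "away D v1 (clockwise (clockwise h1)) = (Suc k, True)"
      "toward D v3 (clockwise (clockwise (clockwise h3))) = (k - 1, True)"
      using side_seats assms by (simp_all add: toward_def away_def arc_at_seat)
    then show ?thesis using potential_across by simp
  qed
qed

end

context triangle_flip_cycles
begin

interpretation r2: triangle_flip_cycles D D' v2 v3 v1 h2 h3 h1 \<gamma> \<gamma>' by (rule rotate_cycles)
interpretation r3: triangle_flip_cycles D D' v3 v1 v2 h3 h1 h2 \<gamma> \<gamma>' by (rule r2.rotate_cycles)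

lemma height_sides: "k \<in> sides \<Longrightarrow>
    height D' \<gamma>' (Suc k) - height D' \<gamma>' (k - 1) = height D \<gamma> (Suc k) - height D \<gamma> (k - 1)"
  using height_across r2.height_across r3.height_across by blast

lemma jump_unflipped:
  assumes "q < length D" "q \<notin> sides" "Suc q \<notin> sides"
  shows "jump D' \<gamma>' (D' ! q) = jump D \<gamma> (D ! q)"
proof -
  have "D' ! q = D ! q" using nth'[OF assms(1)] assms(2,3) by (simp add: flip_def)
  moreover have "crossing (D ! q) \<in> vertices D" "crossing (D ! q) \<notin> {v1, v2, v3}"
    using flipped_iff assms by blast+
  note arcs_other[OF this]
  ultimately show ?thesis
    unfolding jump_def using agree by (simp del: arc_at.simps)
qed

text \<open>A step of the induction along the line passes the two crossings on a side together, since the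
  height between them may change.\<close>

lemma height_outer:
  assumes "k \<le> length D" "k \<notin> sides"
  shows "height D' \<gamma>' k = height D \<gamma> k"
  using assms
proof (induction k rule: less_induct)
  case (less k)
  show ?case
  proof (cases k)
    case (Suc q)
    show ?thesis
    proof (cases "q \<in> sides")
      case True
      then have "q - 1 < k" "q - 1 \<le> length D" "q - 1 \<notin> sides"
        using sides_not_adjacent(2) less Suc by auto
      then have "height D' \<gamma>' (q - 1) = height D \<gamma> (q - 1)" using less.IH by blast
      then show ?thesis using height_sides[OF True] Suc by simp
    next
      case False
      then have "height D' \<gamma>' q = height D \<gamma> q" using less Suc by simp
      moreover have "jump D' \<gamma>' (D' ! q) = jump D \<gamma> (D ! q)"
        using jump_unflipped False less Suc by simp
      ultimately show ?thesis using less.prems Suc height_Suc[of q D \<gamma>] height_Suc[of q D' \<gamma>'] len by simp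
    qed
  qed simp
qed

lemma potential_outer:
  "fst d \<in> arcs D - sides \<Longrightarrow> potential D' \<gamma>' d = potential D \<gamma> d"
  using height_outer agree by (intro potential_cong) (auto simp: arcs_def)

text \<open>After the move the sector at \<open>v1\<close> that the triangle used to occupy lies between two outer ends,
  where the potential is the old one.\<close>

lemma index_v1: "crossing_index D' \<gamma>' v1 = crossing_index D \<gamma> v1"
proof -
  have "zscale (corner_sign h1) (crossing_index D' \<gamma>' v1) =
      potential D' \<gamma>' (toward D v3 (clockwise (clockwise (clockwise h3)))) -
      potential D' \<gamma>' (away D v2 (clockwise (clockwise h2)))"
    using potential_turn_left[OF long' cycle', of v1 h1] vertices vertices_eq darts' r2.darts' by simp
  also have "\<dots> = potential D \<gamma> (toward D v3 (clockwise (clockwise (clockwise h3)))) -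
      potential D \<gamma> (away D v2 (clockwise (clockwise h2)))"
    using potential_outer outer r2.outer by (simp add: insert_commute)
  also have "\<dots> = potential D \<gamma> (toward D v1 h1) - potential D \<gamma> (toward D v2 h2)"
    using side_potential r2.side_potential by simp
  also have "\<dots> = zscale (corner_sign h1) (crossing_index D \<gamma> v1)"
    using potential_turn_left[OF long cycle, of v1 h1] vertices side2 by simp
  finally show ?thesis by (simp add: corner_sign_def split: if_splits)
qed

lemma index_other:
  assumes "v \<in> vertices D" "v \<notin> {v1, v2, v3}"
  shows "crossing_index D' \<gamma>' v = crossing_index D \<gamma> v"
proof -
  have "height D' \<gamma>' (arc_at D v h) = height D \<gamma> (arc_at D v h)" "\<gamma>' (arc_at D v h) = \<gamma> (arc_at D v h)" for h
    using arcs_other(2)[OF assms, of h] height_outer agree by (auto simp: arcs_def)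
  then show ?thesis by (simp only: crossing_index_def arcs_other(1)[OF assms])
qed

end

lemma (in triangle_flip_cycles) index_flip:
  assumes "v \<in> vertices D"
  shows "crossing_index D' \<gamma>' v = crossing_index D \<gamma> v"
proof -
  interpret r2: triangle_flip_cycles D D' v2 v3 v1 h2 h3 h1 \<gamma> \<gamma>' by (rule rotate_cycles)
  interpret r3: triangle_flip_cycles D D' v3 v1 v2 h3 h1 h2 \<gamma> \<gamma>' by (rule r2.rotate_cycles)
  show ?thesis using index_v1 r2.index_v1 r3.index_v1 index_other[OF assms] by blast
qed

lemma long_swap_ends:
  assumes "k \<in> {0<..<length D}"
  shows "long_diagram (swap_ends k D) \<longleftrightarrow> long_diagram D"
proof -
  have k: "k - 1 < length D" "k < length D" using assms by auto
  let ?t = "\<lambda>x. (crossing x, over x)"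
  have "set (swap_ends k D) = set D" unfolding swap_ends_def using k by (rule set_swap)
  moreover have "distinct (map ?t (swap_ends k D)) \<longleftrightarrow> distinct (map ?t D)"
    using distinct_swap[of "k - 1" "map ?t D" k] k
    by (simp add: swap_ends_def map_update)
  ultimately show ?thesis by (simp only: long_diagram_def)
qed

lemma length_swap_ends [simp]: "length (swap_ends k D) = length D"
  by (simp add: swap_ends_def)

lemma nth_swap_ends:
  "k \<in> {0<..<length D} \<Longrightarrow> q < length D \<Longrightarrow>
   swap_ends k D ! q = D ! (if q = k then k - 1 else if Suc q = k then k else q)"
  by (auto simp: swap_ends_def nth_list_update)

lemma nth_swap_flip:
  assumes "k \<in> {0<..<length E}" "q < length E" "k \<notin> S" "Suc k \<notin> S" "k - 1 \<notin> S"
    and E: "\<And>q. q < length E \<Longrightarrow> E ! q = D ! flip S q"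
  shows "swap_ends k E ! q = D ! flip (insert k S) q"
proof -
  have k: "0 < k" "k < length E" "k - 1 < length E" "Suc (k - 1) = k" using assms by auto
  consider "q = k" | "Suc q = k" | "q \<noteq> k" "Suc q \<noteq> k" by blast
  then show ?thesis
  proof cases
    case 1
    then have "swap_ends k E ! q = E ! (k - 1)" using nth_swap_ends assms by simp
    also have "\<dots> = D ! (k - 1)" using E[of "k - 1"] assms k by (simp add: flip_def)
    finally show ?thesis using 1 by (simp add: flip_def)
  next
    case 2
    then have "swap_ends k E ! q = E ! k" using nth_swap_ends assms by simp
    also have "\<dots> = D ! k" using E[of k] assms k by (simp add: flip_def)
    finally show ?thesis using 2 assms by (auto simp: flip_def)
  next
    case 3
    then have "swap_ends k E ! q = D ! flip S q" using nth_swap_ends assms by simp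
    then show ?thesis using 3 by (simp add: flip_def)
  qed
qed

lemma nth_swap_three:
  assumes "k1 \<in> {0<..<length D}" "k2 \<in> {0<..<length D}" "k3 \<in> {0<..<length D}" "q < length D"
    and "k1 \<noteq> k2" "Suc k1 \<noteq> k2" "k1 \<noteq> Suc k2" "k2 \<noteq> k3" "Suc k2 \<noteq> k3" "k2 \<noteq> Suc k3"
      "k3 \<noteq> k1" "Suc k3 \<noteq> k1" "k3 \<noteq> Suc k1"
  shows "swap_ends k1 (swap_ends k2 (swap_ends k3 D)) ! q = D ! flip {k1, k2, k3} q"
proof (rule nth_swap_flip)
  show "swap_ends k2 (swap_ends k3 D) ! q = D ! flip {k2, k3} q"
    if q: "q < length (swap_ends k2 (swap_ends k3 D))" for q
  proof (rule nth_swap_flip)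
    show "swap_ends k3 D ! q = D ! flip {k3} q" if "q < length (swap_ends k3 D)" for q
      by (rule nth_swap_flip) (use assms that in \<open>auto simp: flip_def\<close>)
  qed (use assms q in auto)
qed (use assms in auto)

lemma R3_decompose:
  assumes "R3 D d1 d2 d3 A D'"
  obtains v1 v2 v3 h1 h2 h3 where "triangle_flip D D' v1 v2 v3 h1 h2 h3"
    "d1 = toward D v1 h1" "d2 = toward D v2 h2" "d3 = toward D v3 h3"
    "A = Id_on (arcs D - {arc_at D v1 h1, arc_at D v2 h2, arc_at D v3 h3})"
  using assms
proof (cases rule: R3.cases)
  case 1
  obtain v1 h1 v2 h2 v3 h3 where
    arr: "arrival D d1 = (v1, h1)" "arrival D d2 = (v2, h2)" "arrival D d3 = (v3, h3)" by force
  have bounded: "fst d \<in> {0<..<length D} \<Longrightarrow> reaches D d" for d by (auto simp: reaches_def)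
  have range: "fst d1 \<in> {0<..<length D}" "fst d2 \<in> {0<..<length D}" "fst d3 \<in> {0<..<length D}"
    and turn: "turn_left D d1 = d2" "turn_left D d2 = d3" "turn_left D d3 = d1"
    and dist: "v1 \<noteq> v2" "v2 \<noteq> v3" "v3 \<noteq> v1"
    using 1(4) arr by (auto simp: triangle_def)
  note c1 = arrival_cases[OF 1(3) bounded[OF range(1)] arr(1)]
  note c2 = arrival_cases[OF 1(3) bounded[OF range(2)] arr(2)]
  note c3 = arrival_cases[OF 1(3) bounded[OF range(3)] arr(3)]
  have sides: "away D v3 (clockwise h3) = toward D v1 h1" "away D v1 (clockwise h1) = toward D v2 h2"
    "away D v2 (clockwise h2) = toward D v3 h3"
    using turn turn_left_toward[OF 1(3)] c1 c2 c3 by metis+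
  have fsts: "fst d1 = arc_at D v1 h1" "fst d2 = arc_at D v2 h2" "fst d3 = arc_at D v3 h3"
    using c1(2) c2(2) c3(2) by (simp_all add: toward_def)
  let ?E = "swap_ends (fst d2) (swap_ends (fst d3) D)"
  have long': "long_diagram D'" unfolding 1(2) using 1(3) range long_swap_ends by simp
  interpret f: triangle_face D v1 v2 v3 h1 h2 h3
    by unfold_locales (use 1(3) c1(1) c2(1) c3(1) dist sides in auto)
  interpret f2: triangle_face D v2 v3 v1 h2 h3 h1 by (rule f.rotate_face)
  interpret f3: triangle_face D v3 v1 v2 h3 h1 h2 by (rule f2.rotate_face)
  have nth': "D' ! q = D ! flip f.sides q" if q: "q < length D" for q
    unfolding 1(2) fsts
    by (rule nth_swap_three) (use q range fsts f.side_neighbours f2.side_neighbours f3.side_neighbours in auto)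
  show thesis
  proof (rule that)
    show "triangle_flip D D' v1 v2 v3 h1 h2 h3"
      by unfold_locales (use long' nth' in \<open>simp_all add: 1(2)\<close>)
    show "A = Id_on (arcs D - f.sides)" unfolding 1(1) fsts ..
  qed (fact c1(2) c2(2) c3(2))+
qed


section \<open>Moves and long virtual knots\<close>

lemma long_diagram_rename:
  assumes "long_diagram D" "inj_on f (vertices D)"
  shows "long_diagram (map (rename f) D)"
proof -
  have "distinct D" "inj_on (\<lambda>x. (crossing x, over x)) (set D)"
    using assms(1) by (auto simp: long_diagram_def distinct_map)
  moreover have "inj_on (\<lambda>x. (f (crossing x), over x)) (set D)"
  proof (rule inj_onI)
    fix x y assume xy: "x \<in> set D" "y \<in> set D" "(f (crossing x), over x) = (f (crossing y), over y)"
    then have "crossing x = crossing y"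
      using inj_onD[OF assms(2), of "crossing x" "crossing y"] by (auto simp: vertices_def)
    then show "x = y" using xy inj_onD[OF calculation(2), of x y] by auto
  qed
  ultimately have "distinct (map (\<lambda>x. (crossing x, over x)) (map (rename f) D))"
    by (simp add: distinct_map comp_def)
  moreover have "opposite (rename f x) \<in> rename f ` set D" if "x \<in> set D" for x
    using assms(1) that by (auto simp: long_diagram_def simp flip: rename_simps(5))
  ultimately show ?thesis by (auto simp: long_diagram_def)
qed

lemma rename_index:
  fixes \<gamma> \<gamma>' :: "nat \<Rightarrow> 'a::ab_group_add"
  assumes long: "long_diagram D" and inj: "inj_on f (vertices D)"
    and agree: "\<And>k. k \<in> arcs D \<Longrightarrow> \<gamma> k = \<gamma>' k" and v: "v \<in> vertices D"
  shows "crossing_index (map (rename f) D) \<gamma>' (f v) = crossing_index D \<gamma> v"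
proof -
  let ?D = "map (rename f) D"
  have long': "long_diagram ?D" by (rule long_diagram_rename[OF long inj])
  have "position ?D (f v) r = position D v r" if "v \<in> vertices D" for v r
    using position[OF long that] by (intro position_eqI[OF long']) simp_all
  then have arc: "arc_at ?D (f v) h = arc_at D v h" if "v \<in> vertices D" for v h
    using that by (cases h) simp_all
  have agree': "\<gamma>' (arc_at D v h) = \<gamma> (arc_at D v h)" if "v \<in> vertices D" for v h
    using agree[OF arc_at_in_arcs[OF long that]] by simp
  have "jump ?D \<gamma>' (rename f x) = jump D \<gamma> x" if "x \<in> set D" for x
    using that arc[of "crossing x"] agree'[of "crossing x"]
    by (simp add: jump_def vertices_def del: arc_at.simps)
  then have "height ?D \<gamma>' k = height D \<gamma> k" for k
    unfolding height_def take_map map_map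
    by (intro arg_cong[where f = sum_list] map_cong) (auto dest: in_set_takeD)
  then show ?thesis
    using arc[OF v] agree'[OF v] by (simp add: crossing_index_def del: arc_at.simps)
qed

lemma R3_long:
  assumes "R3 D d1 d2 d3 A D'"
  shows "long_diagram D" "long_diagram D'" "vertices D' = vertices D" "A \<subseteq> arcs D \<times> arcs D'"
proof -
  obtain v1 v2 v3 h1 h2 h3 where f: "triangle_flip D D' v1 v2 v3 h1 h2 h3"
    and A: "A = Id_on (arcs D - {arc_at D v1 h1, arc_at D v2 h2, arc_at D v3 h3})"
    using assms by (rule R3_decompose)
  interpret triangle_flip D D' v1 v2 v3 h1 h2 h3 by (rule f)
  show "long_diagram D" "long_diagram D'" "vertices D' = vertices D"
    by (rule long, rule long', rule vertices_eq)
  show "A \<subseteq> arcs D \<times> arcs D'" by (auto simp: A arcs_def len)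
qed

lemma R3_index:
  fixes \<gamma> \<gamma>' :: "nat \<Rightarrow> 'a::ab_group_add"
  assumes "R3 D d1 d2 d3 A D'" "\<gamma> \<in> H1 D" "\<gamma>' \<in> H1 D'"
    and "\<And>k k'. (k, k') \<in> A \<Longrightarrow> \<gamma> k = \<gamma>' k'" and v: "v \<in> vertices D"
  shows "crossing_index D \<gamma> v = crossing_index D' \<gamma>' v"
proof -
  obtain v1 v2 v3 h1 h2 h3 where f: "triangle_flip D D' v1 v2 v3 h1 h2 h3"
    and A: "A = Id_on (arcs D - {arc_at D v1 h1, arc_at D v2 h2, arc_at D v3 h3})"
    using assms(1) by (rule R3_decompose)
  interpret triangle_flip D D' v1 v2 v3 h1 h2 h3 by (rule f)
  interpret triangle_flip_cycles D D' v1 v2 v3 h1 h2 h3 \<gamma> \<gamma>'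
    by unfold_locales (use assms(2,3) assms(4) A in auto)
  show ?thesis using index_flip[OF v] by simp
qed

lemma move_properties:
  assumes "move D F A D'"
  shows "long_diagram D" "long_diagram D'" "F \<subseteq> vertices D \<times> vertices D'" "A \<subseteq> arcs D \<times> arcs D'"
proof -
  have "long_diagram D \<and> long_diagram D' \<and> F \<subseteq> vertices D \<times> vertices D' \<and> A \<subseteq> arcs D \<times> arcs D'"
    using assms
  proof induction
    case (renaming D f)
    moreover have "vertices (map (rename f) D) = f ` vertices D"
      by (simp add: vertices_def image_image)
    ultimately show ?case
      using long_diagram_rename by (auto simp: arcs_def)
  next
    case (first D v A D')
    then show ?case using R1_long[OF first] by (auto simp: Id_on_def)
  next
    case (second D v w A D')
    then show ?case using R2_long[OF second] by (auto simp: Id_on_def)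
  next
    case (third D d1 d2 d3 A D')
    then show ?case using R3_long[OF third] by (auto simp: Id_on_def)
  qed auto
  then show "long_diagram D" "long_diagram D'" "F \<subseteq> vertices D \<times> vertices D'" "A \<subseteq> arcs D \<times> arcs D'"
    by auto
qed

lemma move_index:
  fixes \<gamma> \<gamma>' :: "nat \<Rightarrow> 'a::ab_group_add"
  assumes "move D F A D'" "\<gamma> \<in> H1 D" "\<gamma>' \<in> H1 D'" "\<forall>(k, k') \<in> A. \<gamma> k = \<gamma>' k'" "(v, v') \<in> F"
  shows "crossing_index D \<gamma> v = crossing_index D' \<gamma>' v'"
  using assms
proof (induction arbitrary: \<gamma> \<gamma>' v v')
  case (renaming D f)
  then have "\<gamma> k = \<gamma>' k" if "k \<in> arcs D" for k using that by auto
  then show ?case using rename_index[OF renaming(1,2), of \<gamma> \<gamma>' v] renaming.prems(4) by auto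
next
  case (first D w A D')
  then show ?case using R1_index_survives[of D w A D' \<gamma> \<gamma>' v] by auto
next
  case (second D w w' A D')
  then show ?case using R2_index_survives[of D w w' A D' \<gamma> \<gamma>' v] by auto
next
  case (third D d1 d2 d3 A D')
  then show ?case using R3_index[of D d1 d2 d3 A D' \<gamma> \<gamma>' v] by auto
next
  case (inverse D F A D')
  have "\<gamma>' k = \<gamma> k'" if "(k, k') \<in> A" for k k'
  proof -
    from that have "(k', k) \<in> A\<inverse>" by simp
    from bspec[OF inverse.prems(3) this] show ?thesis by simp
  qed
  then have "crossing_index D \<gamma>' v' = crossing_index D' \<gamma> v"
    using inverse.prems by (intro inverse.IH) auto
  then show ?case by simp
qed

lemma knot_long:
  assumes "K \<in> long_virtual_knots" "D \<in> K"
  shows "long_diagram D"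
  using assms by (auto simp: long_virtual_knots_def quotient_def same_knot_def)

lemma knot_move:
  assumes "K \<in> long_virtual_knots" "D \<in> K" "move D F A D'"
  shows "D' \<in> K"
proof -
  obtain D0 where K: "K = same_knot `` {D0}"
    using assms(1) by (auto simp: long_virtual_knots_def elim: quotientE)
  then have "(D0, D) \<in> same_knot" using assms(2) by simp
  then have "(\<lambda>E E'. \<exists>F A. move E F A E')\<^sup>*\<^sup>* D0 D'" "long_diagram D0" "long_diagram D'"
    using assms(3) move_properties(2)[OF assms(3)]
    by (auto simp: same_knot_def intro: rtranclp.rtrancl_into_rtrancl)
  then show ?thesis by (simp add: K same_knot_def)
qed

lemma cycle_parity_index:
  "long_diagram D \<Longrightarrow> v \<in> vertices D \<Longrightarrow> cycle_parity \<delta> D v = crossing_index D (\<delta> D) v"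
  by (simp add: cycle_parity_def intersection_closed_half)

text \<open>On the boundary walk of a triangle the differences of potentials at the three vertices telescope,
  which is (P3+).\<close>

theorem cycle_parity_oriented:
  fixes \<delta> :: "diagram \<Rightarrow> nat \<Rightarrow> 'a::ab_group_add"
  assumes K: "K \<in> long_virtual_knots" and \<delta>: "invariant_cycle K \<delta>"
  shows "oriented_parity K (cycle_parity \<delta>)"
proof -
  have cycle: "\<delta> D \<in> H1 D" if "D \<in> K" for D
    using \<delta> that by (simp add: invariant_cycle_def)
  have inv: "\<delta> D k = \<delta> D' k'" if "D \<in> K" "D' \<in> K" "move D F A D'" "(k, k') \<in> A" for D D' F A k k'
    using \<delta> that unfolding invariant_cycle_def by blast
  show ?thesis
    unfolding oriented_parity_def
  proof (intro conjI ballI allI impI)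
    fix D D' F A and vv
    assume m: "D \<in> K" "D' \<in> K" "move D F A D'" "vv \<in> F"
    obtain v v' where vv: "vv = (v, v')" by force
    then have "v \<in> vertices D" "v' \<in> vertices D'" using move_properties(3)[OF m(3)] m(4) by auto
    moreover have "crossing_index D (\<delta> D) v = crossing_index D' (\<delta> D') v'"
      by (rule move_index[OF m(3)]) (use m vv cycle inv[OF m(1-3)] in auto)
    ultimately show "case vv of (v, v') \<Rightarrow> cycle_parity \<delta> D v = cycle_parity \<delta> D' v'"
      using vv move_properties(1,2)[OF m(3)] by (simp add: cycle_parity_index)
  next
    fix D D' v A assume m: "D \<in> K" "D' \<in> K" "R1 D v A D'"
    note agree = inv[OF m(1,2) move.first[OF m(3)]]
    show "cycle_parity \<delta> D v = 0"
      using R1_index_removed[OF m(3) agree] cycle_parity_index[of D v \<delta>]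
        R1_long[OF m(3)] by simp
  next
    fix D D' v1 v2 A assume m: "D \<in> K" "D' \<in> K" "R2 D v1 v2 A D'"
    note agree = inv[OF m(1,2) move.second[OF m(3)]]
    show "cycle_parity \<delta> D v1 + cycle_parity \<delta> D v2 = 0"
      using R2_index_removed[OF m(3) agree] cycle_parity_index[of D _ \<delta>]
        R2_long[OF m(3)] by simp
  next
    fix D D' d1 d2 d3 A assume m: "D \<in> K" "D' \<in> K" "R3 D d1 d2 d3 A D'"
    obtain v1 v2 v3 h1 h2 h3 where f: "triangle_flip D D' v1 v2 v3 h1 h2 h3"
      and d: "d1 = toward D v1 h1" "d2 = toward D v2 h2" "d3 = toward D v3 h3"
      using m(3) by (rule R3_decompose)
    interpret triangle_flip D D' v1 v2 v3 h1 h2 h3 by (rule f)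
    show "(\<Sum>d\<leftarrow>[d1, d2, d3]. zscale (triangle_sign D d) (cycle_parity \<delta> D (fst (arrival D d)))) = 0"
      using potential_turn_left[OF long cycle[OF m(1)], symmetric] vertices
      by (simp add: d triangle_sign_eq arrival_toward long cycle_parity_index side1 side2 side3)
  qed
qed


section \<open>Fingers\<close>

text \<open>The beginning of the line is pushed over the arc \<open>k\<close>, against the direction of travel that
  \<open>f\<close> prescribes on this arc; it is rising at the new crossing \<open>a\<close> and falling at \<open>b\<close>. The
  passages on the arc are the same for both values of \<open>f\<close>.\<close>

fun finger :: "diagram \<Rightarrow> nat \<times> bool \<Rightarrow> nat \<Rightarrow> nat \<Rightarrow> diagram" where
  "finger D (k, f) a b =
     (if f then [Passage a True True, Passage b True False]
      else [Passage b True False, Passage a True True]) @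
     take k D @ [Passage b False False, Passage a False True] @ drop k D"

declare finger.simps [simp del]

definition fresh :: "diagram \<Rightarrow> nat \<Rightarrow> nat \<Rightarrow> bool" where
  "fresh D a b \<longleftrightarrow> a \<noteq> b \<and> a \<notin> vertices D \<and> b \<notin> vertices D"

text \<open>The position in \<open>finger D (k, f) a b\<close> of the passage that has position \<open>q\<close> in \<open>D\<close>.\<close>

definition shift :: "nat \<Rightarrow> nat \<Rightarrow> nat" where
  "shift k q = (if q < k then q + 2 else q + 4)"

lemma finite_vertices: "finite (vertices D)"
  by (simp add: vertices_def)

lemma fresh_exists: "\<exists>a b. fresh D a b \<and> fresh E a b"
proof -
  have fin: "finite (vertices D \<union> vertices E)" by (simp add: finite_vertices)
  obtain a where a: "a \<notin> vertices D \<union> vertices E" using ex_new_if_finite[OF infinite_UNIV_nat fin] by blast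
  obtain b where b: "b \<notin> insert a (vertices D \<union> vertices E)"
    using ex_new_if_finite[OF infinite_UNIV_nat, of "insert a (vertices D \<union> vertices E)"] fin by blast
  show ?thesis using a b by (auto simp: fresh_def)
qed

lemma set_finger: "set (finger D d a b) = {Passage a True True, Passage b True False,
    Passage b False False, Passage a False True} \<union> set D"
proof -
  obtain k f where "d = (k, f)" by force
  moreover have "set D = set (take k D) \<union> set (drop k D)"
    by (metis append_take_drop_id set_append)
  ultimately show ?thesis by (auto simp: finger.simps)
qed

lemma vertices_finger: "vertices (finger D d a b) = {a, b} \<union> vertices D"
  unfolding vertices_def set_finger by auto

lemma long_finger:
  assumes "long_diagram D" "fresh D a b"
  shows "long_diagram (finger D d a b)"
proof -
  obtain k f where d: "d = (k, f)" by force
  have "opposite x \<in> set (finger D d a b)" if "x \<in> set (finger D d a b)" for x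
    using that assms(1) unfolding set_finger long_diagram_def by auto
  moreover have "distinct (map (\<lambda>x. (crossing x, over x)) (finger D d a b))"
  proof -
    let ?t = "\<lambda>x. (crossing x, over x)"
    obtain u w where uw: "take k D = u" "drop k D = w" "D = u @ w"
      using append_take_drop_id[of k D] by metis
    have "distinct (map ?t (u @ w))"
      using assms(1) by (simp add: long_diagram_def uw(3))
    moreover have "crossing x \<noteq> a \<and> crossing x \<noteq> b" if "x \<in> set u \<union> set w" for x
      using that assms(2) by (auto simp: fresh_def vertices_def uw(3))
    moreover have "a \<noteq> b" using assms(2) by (simp add: fresh_def)
    ultimately show ?thesis by (auto simp: d finger.simps uw(1,2))
  qed
  ultimately show ?thesis by (simp add: long_diagram_def)
qed

lemma length_finger: "length (finger D d a b) = length D + 4"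
  by (cases d) (auto simp: finger.simps)

lemma nth_finger:
  assumes "k \<le> length D"
  shows "finger D (k, f) a b ! 0 = (if f then Passage a True True else Passage b True False)"
    and "finger D (k, f) a b ! 1 = (if f then Passage b True False else Passage a True True)"
    and "finger D (k, f) a b ! (k + 2) = Passage b False False"
    and "finger D (k, f) a b ! (k + 3) = Passage a False True"
    and "q < length D \<Longrightarrow> finger D (k, f) a b ! shift k q = D ! q"
proof -
  show "finger D (k, f) a b ! 0 = (if f then Passage a True True else Passage b True False)"
    "finger D (k, f) a b ! 1 = (if f then Passage b True False else Passage a True True)"
    by (auto simp: finger.simps)
  show "finger D (k, f) a b ! (k + 2) = Passage b False False"
    "finger D (k, f) a b ! (k + 3) = Passage a False True"
    using assms by (simp_all add: finger.simps nth_append)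
  show "finger D (k, f) a b ! shift k q = D ! q" if "q < length D"
  proof (cases "q < k")
    case True
    then show ?thesis using assms by (simp add: finger.simps shift_def nth_append)
  next
    case False
    then have "q + 4 = Suc (Suc (k + Suc (Suc (q - k))))" by simp
    then show ?thesis using assms False that by (simp add: finger.simps shift_def nth_append del: add_Suc_right)
  qed
qed

lemma shift_cases:
  assumes "i < n + 4" "k \<le> n"
  shows "i = 0 \<or> i = 1 \<or> i = k + 2 \<or> i = k + 3 \<or> (\<exists>q < n. i = shift k q)"
proof -
  have "i = shift k (i - 2)" "i - 2 < n" if "2 \<le> i" "i < k + 2" using that assms by (auto simp: shift_def)
  moreover have "i = shift k (i - 4)" "i - 4 < n" if "k + 4 \<le> i" using that assms by (auto simp: shift_def)
  ultimately show ?thesis by (cases "2 \<le> i"; cases "i < k + 2"; cases "k + 4 \<le> i") (auto; presburger?)+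
qed

lemma shift_less: "q < n \<Longrightarrow> shift k q < n + 4"
  by (simp add: shift_def)

context
  fixes D :: diagram and k :: nat and f :: bool and a b :: nat
  assumes long: "long_diagram D" and fresh: "fresh D a b" and k: "k \<le> length D"
begin

lemma position_finger:
  "v \<in> vertices D \<Longrightarrow> position (finger D (k, f) a b) v r = shift k (position D v r)"
  "position (finger D (k, f) a b) a True = (if f then 0 else 1)"
  "position (finger D (k, f) a b) a False = k + 3"
  "position (finger D (k, f) a b) b True = k + 2"
  "position (finger D (k, f) a b) b False = (if f then 1 else 0)"
  using position[OF long] nth_finger[OF k] k
  by (intro position_eqI[OF long_finger[OF long fresh]];
      simp add: length_finger shift_less rising_def)+

lemma finger_R2:
  obtains A where "R2 (finger D (k, f) a b) (if f then a else b) (if f then b else a) A D"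
    "\<And>i. i \<le> k \<Longrightarrow> (i + 2, i) \<in> A" "\<And>i. k \<le> i \<Longrightarrow> i \<le> length D \<Longrightarrow> (i + 4, i) \<in> A"
    "(k + 2, k) \<in> A"
proof -
  let ?x = "if f then Passage a True True else Passage b True False"
  let ?y = "if f then Passage b True False else Passage a True True"
  let ?q = "[Passage b False False, Passage a False True]"
  have "finger D (k, f) a b = [] @ [?x, ?y] @ take k D @ ?q @ drop k D" by (simp add: finger.simps)
  moreover have "long_diagram (finger D (k, f) a b)" using long_finger long fresh by blast
  ultimately have "R2 ([] @ [?x, ?y] @ take k D @ ?q @ drop k D) (crossing ?x) (crossing ?y)
    ({(k, k) | k. k \<le> length ([] :: diagram)} \<union>
       {(i + 2, i) | i. length ([] :: diagram) \<le> i \<and> i \<le> length ([] @ take k D)} \<union>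
       {(i + 4, i) | i. length ([] @ take k D) \<le> i \<and> i \<le> length ([] @ take k D @ drop k D)})
      ([] @ take k D @ drop k D)"
    by (intro R2.intros) auto
  then show thesis
    using k by (intro that) (auto simp: finger.simps if_distrib[of crossing] split: if_splits)
qed

end

lemma arc_at_finger:
  assumes "long_diagram D" "fresh D a b" "k \<le> length D" "v \<in> vertices D"
  shows "arc_at (finger D (k, f) a b) v h =
    (if outgoing h then Suc (shift k (seat D v h)) else shift k (seat D v h))"
  using position_finger(1)[OF assms(1-3), of v f "strand h"] assms(4)
  by (simp add: arc_at_seat seat_def)

lemma arc_at_finger_correspond:
  assumes "\<And>i. i \<le> k \<Longrightarrow> (i + 2, i) \<in> A" "\<And>i. k \<le> i \<Longrightarrow> i \<le> length D \<Longrightarrow> (i + 4, i) \<in> A"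
    and "long_diagram D" "fresh D a b" "k \<le> length D" "v \<in> vertices D"
  shows "(arc_at (finger D (k, f) a b) v h, arc_at D v h) \<in> A"
proof -
  have "seat D v h < length D" using position_less assms(3,6) by (simp add: seat_def)
  then show ?thesis
    using assms(1)[of "arc_at D v h"] assms(2)[of "arc_at D v h"]
    unfolding arc_at_finger[OF assms(3-6)] arc_at_seat[of D] shift_def
    by (auto simp: not_less)
qed


section \<open>Fingers and moves\<close>

lemma split_at: "k \<le> length u \<Longrightarrow> \<exists>u1 u2. u = u1 @ u2 \<and> k = length u1"
  by (metis append_take_drop_id length_take min.absorb2)

lemma R1_finger:
  assumes "R1 D v A D'" "(k, k') \<in> A" "fresh D a b"
  shows "\<exists>B. R1 (finger D (k, f) a b) v B (finger D' (k', f) a b)"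
proof -
  obtain u x w where D: "D = u @ [x, opposite x] @ w" "D' = u @ w" "v = crossing x"
    and long: "long_diagram D"
    and A: "A = {(k, k) | k. k \<le> length u} \<union> {(k + 2, k) | k. length u \<le> k \<and> k \<le> length (u @ w)}"
    using assms(1) by (rule R1.cases) (rule that; (assumption | simp only:))
  define front where "front = (if f then [Passage a True True, Passage b True False]
      else [Passage b True False, Passage a True True])"
  define mid where "mid = [Passage b False False, Passage a False True]"
  have fing: "finger (s @ t) (length s, f) a b = front @ s @ mid @ t" for s t
    by (simp add: finger.simps front_def mid_def)
  note long_f = long_finger[OF long assms(3), of "(k, f)"]
  consider "k' = k" "k \<le> length u" | c where "k = k' + 2" "k' = length u + c" "c \<le> length w"
    using assms(2) by (auto simp: A le_iff_add)
  then show ?thesis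
  proof cases
    case 1
    then obtain s t where st: "u = s @ t" "k = length s" using split_at by blast
    have "D = s @ t @ [x, opposite x] @ w" "D' = s @ t @ w" by (simp_all add: D st)
    then have "finger D (k, f) a b = (front @ s @ mid @ t) @ [x, opposite x] @ w"
      "finger D' (k', f) a b = (front @ s @ mid @ t) @ w"
      by (simp_all only: 1 st fing append_assoc)
    then show ?thesis using R1.intros[of "front @ s @ mid @ t" x w] long_f D(3) by metis
  next
    case 2
    then obtain s t where st: "w = s @ t" "c = length s" using split_at by blast
    have e: "k = length (u @ [x, opposite x] @ s)" "k' = length (u @ s)"
      "D = (u @ [x, opposite x] @ s) @ t" "D' = (u @ s) @ t"
      using 2 st by (simp_all add: D)
    have "finger D (k, f) a b = front @ (u @ [x, opposite x] @ s) @ mid @ t"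
      "finger D' (k', f) a b = front @ (u @ s) @ mid @ t"
      unfolding e by (rule fing)+
    then have "finger D (k, f) a b = (front @ u) @ [x, opposite x] @ s @ mid @ t"
      "finger D' (k', f) a b = (front @ u) @ s @ mid @ t"
      by (simp_all only: append_assoc)
    then show ?thesis using R1.intros[of "front @ u" x "s @ mid @ t"] long_f D(3) by metis
  qed
qed

lemma R2_finger:
  assumes "R2 D v v' A D'" "(k, k') \<in> A" "fresh D a b"
  shows "\<exists>B. R2 (finger D (k, f) a b) v v' B (finger D' (k', f) a b)"
proof -
  obtain u x y m q w where D: "D = u @ [x, y] @ m @ q @ w" "D' = u @ m @ w" "v = crossing x" "v' = crossing y"
    and long: "long_diagram D" and xy: "over x = over y" "positive x \<noteq> positive y"
    and q: "q = [opposite x, opposite y] \<or> q = [opposite y, opposite x]"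
    and A: "A = {(k, k) | k. k \<le> length u} \<union> {(k + 2, k) | k. length u \<le> k \<and> k \<le> length (u @ m)} \<union>
       {(k + 4, k) | k. length (u @ m) \<le> k \<and> k \<le> length (u @ m @ w)}"
    using assms(1) by (rule R2.cases) (rule that; (assumption | simp only:))
  define front where "front = (if f then [Passage a True True, Passage b True False]
      else [Passage b True False, Passage a True True])"
  define mid where "mid = [Passage b False False, Passage a False True]"
  have fing: "finger (s @ t) (length s, f) a b = front @ s @ mid @ t" for s t
    by (simp add: finger.simps front_def mid_def)
  note long_f = long_finger[OF long assms(3), of "(k, f)"]
  have intro: "\<exists>B. R2 (finger D (k, f) a b) v v' B (finger D' (k', f) a b)"
    if "finger D (k, f) a b = U @ [x, y] @ M @ q @ W" "finger D' (k', f) a b = U @ M @ W" for U M W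
    using R2.intros[of U x y M q W] long_f xy q D(3,4) that by metis
  have lq: "length q = 2" using q by auto
  have "k' = k \<and> k \<le> length u \<or>
      k = k' + 2 \<and> length u \<le> k' \<and> k' \<le> length u + length m \<or>
      k = k' + 4 \<and> length u + length m \<le> k' \<and> k' \<le> length u + (length m + length w)"
    using assms(2) unfolding A by simp
  then have "k' = k \<and> k \<le> length u \<or>
      k = k' + 2 \<and> length u \<le> k' \<and> k' - length u \<le> length m \<or>
      k = k' + 4 \<and> length u + length m \<le> k' \<and> k' - (length u + length m) \<le> length w"
    by linarith
  then consider "k' = k" "k \<le> length u"
    | "k = k' + 2" "length u \<le> k'" "k' - length u \<le> length m"
    | "k = k' + 4" "length u + length m \<le> k'" "k' - (length u + length m) \<le> length w"
    by blast
  then show ?thesis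
  proof cases
    case 1
    then obtain s t where st: "u = s @ t" "k = length s" using split_at by blast
    have "D = s @ t @ [x, y] @ m @ q @ w" "D' = s @ t @ m @ w" by (simp_all add: D st)
    then have "finger D (k, f) a b = (front @ s @ mid @ t) @ [x, y] @ m @ q @ w"
      "finger D' (k', f) a b = (front @ s @ mid @ t) @ m @ w"
      by (simp_all only: 1 st fing append_assoc)
    then show ?thesis by (rule intro)
  next
    case 2
    then obtain s t where st: "m = s @ t" "k' - length u = length s" using split_at by blast
    have e: "k = length (u @ [x, y] @ s)" "k' = length (u @ s)"
      "D = (u @ [x, y] @ s) @ t @ q @ w" "D' = (u @ s) @ t @ w"
      using 2(1,2) st by (simp_all add: D)
    have "finger D (k, f) a b = front @ (u @ [x, y] @ s) @ mid @ t @ q @ w"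
      "finger D' (k', f) a b = front @ (u @ s) @ mid @ t @ w"
      unfolding e by (rule fing)+
    then have "finger D (k, f) a b = (front @ u) @ [x, y] @ (s @ mid @ t) @ q @ w"
      "finger D' (k', f) a b = (front @ u) @ (s @ mid @ t) @ w"
      by (simp_all only: append_assoc)
    then show ?thesis by (rule intro)
  next
    case 3
    then obtain s t where st: "w = s @ t" "k' - (length u + length m) = length s" using split_at by blast
    have e: "k = length (u @ [x, y] @ m @ q @ s)" "k' = length (u @ m @ s)"
      "D = (u @ [x, y] @ m @ q @ s) @ t" "D' = (u @ m @ s) @ t"
      using 3(1,2) lq st by (simp_all add: D)
    have "finger D (k, f) a b = front @ (u @ [x, y] @ m @ q @ s) @ mid @ t"
      "finger D' (k', f) a b = front @ (u @ m @ s) @ mid @ t"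
      unfolding e by (rule fing)+
    then have "finger D (k, f) a b = (front @ u) @ [x, y] @ m @ q @ s @ mid @ t"
      "finger D' (k', f) a b = (front @ u) @ m @ s @ mid @ t"
      by (simp_all only: append_assoc)
    then show ?thesis by (rule intro)
  qed
qed

lemma swap_ends_finger:
  assumes "k \<le> length D" "l \<in> {0<..<length D}" "l \<noteq> k"
  shows "swap_ends (shift k l) (finger D (k, f) a b) = finger (swap_ends l D) (k, f) a b"
proof (rule nth_equalityI)
  have l: "shift k l \<in> {0<..<length (finger D (k, f) a b)}" "shift k l - 1 = shift k (l - 1)"
    using assms by (auto simp: shift_def length_finger)
  have k': "k \<le> length (swap_ends l D)" using assms by simp
  show "length (swap_ends (shift k l) (finger D (k, f) a b)) = length (finger (swap_ends l D) (k, f) a b)"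
    by (simp add: length_finger)
  fix i assume "i < length (swap_ends (shift k l) (finger D (k, f) a b))"
  then have i: "i < length (finger D (k, f) a b)" "i < length D + 4" by (simp_all add: length_finger)
  note swap = nth_swap_ends[OF l(1) i(1)]
  consider "i \<in> {0, 1, k + 2, k + 3}" | q where "q < length D" "i = shift k q"
    using shift_cases[OF i(2) assms(1)] by blast
  then show "swap_ends (shift k l) (finger D (k, f) a b) ! i = finger (swap_ends l D) (k, f) a b ! i"
  proof cases
    case 1
    then have "i \<noteq> shift k l" "Suc i \<noteq> shift k l" using assms by (auto simp: shift_def)
    then show ?thesis
      using 1 nth_finger(1-4)[OF assms(1), of f a b] nth_finger(1-4)[OF k', of f a b]
      by (auto simp: swap simp del: One_nat_def)
  next
    case (2 q)
    have "shift k q = shift k l \<longleftrightarrow> q = l" "Suc (shift k q) = shift k l \<longleftrightarrow> Suc q = l"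
      using assms by (auto simp: shift_def)
    moreover have "l < length D" "l - 1 < length D" using assms by auto
    ultimately show ?thesis
      using nth_finger(5)[OF assms(1)] nth_finger(5)[OF k', of q] 2
      by (simp add: swap[unfolded 2(2)] l(2)[unfolded One_nat_def] nth_swap_ends[OF assms(2)])
  qed
qed

text \<open>The new passages separate two neighbours on a strand only if the arc between them is \<open>k\<close>, and
  \<open>k\<close> is not a side of the triangle. So the triangle survives with shifted positions.\<close>

lemma R3_finger:
  assumes "R3 D d1 d2 d3 A D'" "(k, k') \<in> A" "fresh D a b"
  shows "\<exists>e1 e2 e3 B. R3 (finger D (k, f) a b) e1 e2 e3 B (finger D' (k', f) a b)"
  using assms(1)
proof (cases rule: R3.cases)
  case 1
  let ?E = "finger D (k, f) a b"
  define s where "s d = (shift k (fst d), snd d)" for d :: "nat \<times> bool"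
  have k: "k \<le> length D" "k' = k" "k \<noteq> fst d1" "k \<noteq> fst d2" "k \<noteq> fst d3"
    using assms(2) by (auto simp: 1(1) arcs_def)
  have bounded: "fst d1 \<in> {0<..<length D}" "fst d2 \<in> {0<..<length D}" "fst d3 \<in> {0<..<length D}"
    and turn: "turn_left D d1 = d2" "turn_left D d2 = d3" "turn_left D d3 = d1"
    and dist: "distinct [fst (arrival D d1), fst (arrival D d2), fst (arrival D d3)]"
    using 1(4) unfolding triangle_def by blast+
  have pred: "shift k l - 1 = shift k (l - 1)" if "l \<noteq> k" "0 < l" for l
    using that by (auto simp: shift_def)
  have nth: "?E ! shift k l = D ! l" "?E ! (shift k l - 1) = D ! (l - 1)" if "l \<noteq> k" "l \<in> {0<..<length D}" for l
    using that nth_finger(5)[OF k(1), of l f a b] nth_finger(5)[OF k(1), of "l - 1" f a b]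
    by (simp_all add: pred[unfolded One_nat_def] less_imp_diff_less)
  have arrival: "arrival ?E (s d) = arrival D d" if "fst d \<noteq> k" "fst d \<in> {0<..<length D}" for d
    using nth[OF that] by (cases d) (simp add: arrival_def s_def)
  have turn_s: "turn_left ?E (s d) = s (turn_left D d)"
    if d: "fst d \<noteq> k" "fst d \<in> {0<..<length D}" "fst (turn_left D d) \<noteq> k" for d
  proof -
    obtain v h where v: "arrival D d = (v, h)" by force
    have "v \<in> vertices D"
      using arrival_cases(1)[OF 1(3) _ v] d(2) by (auto simp: reaches_def)
    then have "arc_at ?E v (clockwise h) = shift k (arc_at D v (clockwise h))"
      using d(3) arc_at_finger[OF 1(3) assms(3) k(1)] v
      by (auto simp: turn_left_def arc_at_seat[of D] shift_def)
    then show ?thesis using arrival[OF d(1,2)] v by (simp add: turn_left_def s_def)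
  qed
  have "triangle ?E (s d1) (s d2) (s d3)"
  proof -
    have "fst (s d) \<in> {0<..<length ?E}" if "fst d \<in> {0<..<length D}" for d
      using that by (auto simp: s_def shift_def length_finger)
    then show ?thesis
      unfolding triangle_def using turn_s turn dist arrival bounded k(3-5) by metis
  qed
  moreover have two: "\<exists>k \<in> {fst (s d1), fst (s d2), fst (s d3)}. P (?E ! (k - 1)) \<and> P (?E ! k)"
    if "\<exists>k \<in> {fst d1, fst d2, fst d3}. P (D ! (k - 1)) \<and> P (D ! k)" for P
    using that nth bounded k(3-5) by (auto simp: s_def)
  moreover have swap: "swap_ends (fst (s d1)) (swap_ends (fst (s d2)) (swap_ends (fst (s d3)) ?E)) =
      finger D' (k', f) a b"
    using swap_ends_finger[of k] bounded k by (simp add: s_def 1(2))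
  ultimately have "R3 ?E (s d1) (s d2) (s d3) (Id_on (arcs ?E - {fst (s d1), fst (s d2), fst (s d3)}))
      (swap_ends (fst (s d1)) (swap_ends (fst (s d2)) (swap_ends (fst (s d3)) ?E)))"
    using long_finger[OF 1(3) assms(3)] two[of over, OF 1(5)] two[of "\<lambda>x. \<not> over x", OF 1(6)]
    by (intro R3.intros)
  then show ?thesis unfolding swap by blast
qed

lemma rename_finger:
  "map (rename g) (finger D (k, f) a b) = finger (map (rename g) D) (k, f) (g a) (g b)"
  by (simp add: finger.simps take_map drop_map)

text \<open>Correspondent arcs share a point outside the region of the move. With a finger over that point the
  move can still be made, and it keeps the crossings of the finger.\<close>

lemma move_finger:
  assumes "move D F A D'" "(k, k') \<in> A" "fresh D a b" "fresh D' a b"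
  shows "\<exists>F' A'. move (finger D (k, f) a b) F' A' (finger D' (k', f) a b) \<and> (b, b) \<in> F'"
  using assms
proof (induction arbitrary: k k')
  case (renaming D g)
  let ?g = "g(a := a, b := b)"
  have ab: "a \<noteq> b" "a \<notin> vertices D" "b \<notin> vertices D" "a \<notin> g ` vertices D" "b \<notin> g ` vertices D"
    using renaming.prems(2,3) by (auto simp: fresh_def vertices_def image_image)
  have "inj_on ?g (vertices (finger D (k, f) a b))"
    using renaming.hyps(2) ab unfolding vertices_finger by (auto simp: inj_on_def)
  moreover have g: "map (rename ?g) D = map (rename g) D"
  proof (rule map_cong[OF refl])
    fix x assume "x \<in> set D"
    then have "crossing x \<in> vertices D" by (simp add: vertices_def)
    then have "?g (crossing x) = g (crossing x)" using ab by auto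
    then show "rename ?g x = rename g x" by (cases x) simp
  qed
  have "?g a = a" "?g b = b" using ab(1) by simp_all
  then have "map (rename ?g) (finger D (k, f) a b) = finger (map (rename g) D) (k, f) a b"
    by (simp only: rename_finger g)
  ultimately have "move (finger D (k, f) a b)
      {(v, ?g v) | v. v \<in> vertices (finger D (k, f) a b)} (Id_on (arcs (finger D (k, f) a b)))
      (finger (map (rename g) D) (k, f) a b)"
    using move.renaming[of "finger D (k, f) a b" ?g] long_finger[OF renaming.hyps(1) renaming.prems(2)]
    by simp
  moreover have "(b, b) \<in> {(v, ?g v) | v. v \<in> vertices (finger D (k, f) a b)}"
    unfolding vertices_finger by simp
  moreover have "k' = k" using renaming.prems(1) by auto
  ultimately show ?case by blast
next
  case (first D v A D')
  then obtain B where "R1 (finger D (k, f) a b) v B (finger D' (k', f) a b)"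
    using R1_finger by blast
  from move.first[OF this] show ?case unfolding vertices_finger by (intro exI conjI) auto
next
  case (second D v w A D')
  then obtain B where "R2 (finger D (k, f) a b) v w B (finger D' (k', f) a b)"
    using R2_finger by blast
  from move.second[OF this] show ?case unfolding vertices_finger by (intro exI conjI) auto
next
  case (third D d1 d2 d3 A D')
  then obtain e1 e2 e3 B where "R3 (finger D (k, f) a b) e1 e2 e3 B (finger D' (k', f) a b)"
    using R3_finger by blast
  from move.third[OF this] show ?case unfolding vertices_finger by (intro exI conjI) auto
next
  case (inverse D F A D')
  then obtain F' A' where "move (finger D (k', f) a b) F' A' (finger D' (k, f) a b)" "(b, b) \<in> F'"
    by blast
  then show ?case using move.inverse by blast
qed


section \<open>Two fingers around a crossing\<close>

lemma bounded_side:
  assumes "long_diagram D" "v \<in> vertices D" "w \<in> vertices D" "away D v h = toward D w g"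
  shows "fst (toward D w g) \<in> {0<..<length D}"
proof -
  have eq: "arc_at D v h = arc_at D w g" "outgoing h \<longleftrightarrow> \<not> outgoing g"
    using assms(4) by (simp_all add: away_def toward_def)
  have "seat D v h < length D" "seat D w g < length D"
    using position_less[OF assms(1)] assms(2,3) by (simp_all add: seat_def)
  then show ?thesis
    using eq unfolding toward_def arc_at_seat by (cases "outgoing g") auto
qed

lemma (in triangle_face) triangle: "triangle D (toward D v1 h1) (toward D v2 h2) (toward D v3 h3)"
  unfolding triangle_def
  using bounded_side[OF long vertices(3,1) side1] bounded_side[OF long vertices(1,2) side2]
    bounded_side[OF long vertices(2,3) side3] vertices distinct
  by (auto simp: turn_left_toward arrival_toward long side1 side2 side3)

text \<open>The beginning of the line is pushed over the end \<open>h\<close> of \<open>v\<close>, and then its initial piece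
  over the next end clockwise. Between the two fingers it runs directly from the second end to the
  first, and so bounds a triangle together with the two ends. It is on top, and the lower strand at
  \<open>v\<close> is at the bottom.\<close>

lemma double_finger:
  assumes longD: "long_diagram D" and v: "v \<in> vertices D"
    and fresh: "fresh D a b" and fresh': "fresh (finger D (toward D v h) a b) a' b'"
  defines "E \<equiv> finger D (toward D v h) a b"
  defines "E' \<equiv> finger E (away E v (clockwise h)) a' b'"
  defines "d1 \<equiv> toward E' v h"
    and "d2 \<equiv> if outgoing (clockwise h) then toward E' b' SW else toward E' a' NW"
    and "d3 \<equiv> if outgoing h then toward E' b SE else toward E' a SW"
  shows "\<exists>A E''. R3 E' d1 d2 d3 A E''"
proof -
  define k f where "k = arc_at D v h" and "f \<longleftrightarrow> \<not> outgoing h"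
  have d: "toward D v h = (k, f)" by (simp add: toward_def k_def f_def)
  define k' f' where "k' = arc_at E v (clockwise h)" and "f' \<longleftrightarrow> outgoing (clockwise h)"
  have e: "away E v (clockwise h) = (k', f')" by (simp add: away_def k'_def f'_def)
  define i j where "i = seat D v h" and "j = seat D v (clockwise h)"
  have ij: "i < length D" "j < length D" "i \<noteq> j"
    using position_less[OF longD v] position_inj[OF longD v v]
    by (auto simp: i_def j_def seat_def)
  have k: "k = (if f then i else Suc i)" "k \<le> length D"
    using ij by (auto simp: k_def f_def i_def arc_at_seat)
  have E: "E = finger D (k, f) a b" by (simp add: E_def d)
  have E': "E' = finger E (k', f') a' b'" by (simp add: E'_def e)
  have longE: "long_diagram E" using long_finger[OF longD fresh] by (simp add: E_def)
  have freshE: "fresh E a' b'" using fresh' by (simp add: E_def)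
  have longE': "long_diagram E'" using long_finger[OF longE freshE] by (simp add: E'_def)
  have vert: "vertices E = {a, b} \<union> vertices D" "vertices E' = {a', b'} \<union> vertices E"
    unfolding E E' vertices_finger by simp_all
  have lenE: "length E = length D + 4" "length E' = length E + 4"
    unfolding E E' length_finger by simp_all
  have k': "k' = (if f' then Suc (shift k j) else shift k j)" "k' \<le> length E"
    using arc_at_finger[OF longD fresh k(2) v, of f "clockwise h"] ij
    by (auto simp: k'_def f'_def j_def E lenE[unfolded E] shift_def)
  note posE = position_finger[OF longD fresh k(2), where f = f, folded E]
  note posE' = position_finger[OF longE freshE k'(2), where f = f', folded E']
  note nthE = nth_finger[OF k(2), where f = f and a = a and b = b, folded E]
  note nthE' = nth_finger[OF k'(2), where f = f' and a = a' and b = b', folded E']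
  have out: "outgoing h \<longleftrightarrow> \<not> f" "outgoing (clockwise h) \<longleftrightarrow> f'" by (simp_all add: f_def f'_def)
  have seats: "seat E' v h = shift k' (shift k i)" "seat E' v (clockwise h) = shift k' (shift k j)"
    using v by (simp_all add: seat_def posE' posE vert i_def j_def)
  have k'_ne: "0 < k'" "f \<Longrightarrow> k' \<noteq> k + 4" "\<not> f \<Longrightarrow> k' \<noteq> k + 2"
    using k' k ij by (auto simp: shift_def split: if_splits)
  have shift_k: "shift k i = (if f then k + 4 else k + 1)" using k by (simp add: shift_def)
  have beside_v: "(if f then Suc (shift k' (k + 3)) = shift k' (k + 4)
      else Suc (shift k' (k + 1)) = shift k' (k + 2))"
  proof (cases f)
    case True
    then show ?thesis using k'_ne(2) by (auto simp: shift_def)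
  next
    case False
    then show ?thesis using k'_ne(3) by (auto simp: shift_def)
  qed
  have beside_e: "shift k' (shift k j) = (if f' then k' + 1 else k' + 4)"
    using k' by (simp add: shift_def)
  have pos_ab: "position E' a r = shift k' (position E a r)" "position E' b r = shift k' (position E b r)" for r
    using posE'(1) vert by blast+
  \<comment> \<open>The crossings of the fingers next to \<open>v\<close>, and the ends at which the boundary walk arrives there.\<close>
  define c2 g2 c3 g3 where "c2 = (if f' then b' else a')" and "g2 = (if f' then SW else NW)"
    and "c3 = (if f then a else b)" and "g3 = (if f then SW else SE)"
  have d23: "d2 = toward E' c2 g2" "d3 = toward E' c3 g3"
    by (simp_all add: d2_def d3_def out c2_def g2_def c3_def g3_def)
  \<comment> \<open>The arc 2 joins the two fingers.\<close>
  have dart3: "toward E' c3 g3 = (2, True)"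
    using k'_ne(1) by (simp add: toward_def c3_def g3_def pos_ab posE shift_def)
  have dart2: "toward E' c2 g2 = (if f' then (k' + 2, True) else (k' + 4, False))"
    by (simp add: toward_def c2_def g2_def posE')
  have dart1: "toward E' v h = (if f then (shift k' (k + 4), True) else (shift k' (k + 2), False))"
    using beside_v by (simp add: toward_def arc_at_seat seats out shift_k split: if_splits)
  interpret triangle_face E' v c2 c3 h g2 g3
  proof
    show "long_diagram E'" by (rule longE')
    show "v \<in> vertices E'" "c2 \<in> vertices E'" "c3 \<in> vertices E'"
      using v vert by (auto simp: c2_def c3_def)
    show "v \<noteq> c2" "c2 \<noteq> c3" "c3 \<noteq> v"
      using v vert fresh freshE by (auto simp: c2_def c3_def fresh_def)
    show "away E' c3 (clockwise g3) = toward E' v h"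
      unfolding dart1 using beside_v
      by (simp add: away_def c3_def g3_def pos_ab posE)
    show "away E' v (clockwise h) = toward E' c2 g2"
      unfolding dart2 by (simp add: away_def arc_at_seat seats out beside_e)
    show "away E' c2 (clockwise g2) = toward E' c3 g3"
      unfolding dart3 by (simp add: away_def c2_def g2_def posE')
  qed
  have over: "over (E' ! (fst d3 - 1))" "over (E' ! fst d3)"
  proof -
    have "E' ! 2 = E ! 0" using nthE'(5)[of 0] lenE k'_ne(1) by (simp add: shift_def numeral_2_eq_2)
    then show "over (E' ! (fst d3 - 1))" "over (E' ! fst d3)"
      using nthE'(2) nthE(1) by (simp_all add: d23 dart3)
  qed
  have E'_D: "E' ! shift k' (shift k q) = D ! q" if "q < length D" for q
    using nthE(5)[OF that] nthE'(5)[of "shift k q"] shift_less[OF that] lenE by simp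
  have under: "\<exists>l \<in> {fst d1, fst d2}. \<not> over (E' ! (l - 1)) \<and> \<not> over (E' ! l)"
  proof (cases "over (D ! i)")
    case False
    have 1: "\<not> over (E' ! shift k' (k + 3))" "\<not> over (E' ! shift k' (k + 2))"
      using nthE'(5)[of "k + 3"] nthE'(5)[of "k + 2"] nthE(3,4) k(2) lenE by simp_all
    have 2: "\<not> over (E' ! shift k' (if f then k + 4 else k + 1))"
      using E'_D[OF ij(1)] shift_k False by simp
    have "fst d1 = shift k' (k + 4) \<and> fst d1 - 1 = shift k' (k + 3) \<and> f \<or>
        fst d1 = shift k' (k + 2) \<and> fst d1 - 1 = shift k' (k + 1) \<and> \<not> f"
      using beside_v unfolding d1_def dart1 by (auto split: if_splits)
    then show ?thesis using 1 2 by auto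
  next
    case True
    have "over (D ! i) \<noteq> over (D ! j)"
      using long_diagram_over_unique[OF longD ij(1,2)] ij(3) crossing_position[OF longD v]
      by (auto simp: i_def j_def seat_def)
    then have "\<not> over (E' ! (if f' then k' + 1 else k' + 4))"
      using E'_D[OF ij(2)] beside_e True by simp
    moreover have "\<not> over (E' ! (k' + 2))" "\<not> over (E' ! (k' + 3))" using nthE'(3,4) by simp_all
    moreover have "fst d2 = (if f' then k' + 2 else k' + 4)"
        "fst d2 - 1 = (if f' then k' + 1 else k' + 3)"
      unfolding d23 dart2 by simp_all
    ultimately show ?thesis by (auto split: if_splits)
  qed
  have "triangle E' d1 d2 d3" using triangle by (simp add: d1_def d23)
  then show ?thesis using R3.intros[OF longE', of d1 d2 d3] over under by blast
qed


section \<open>The face relation of an oriented parity\<close>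

text \<open>This becomes the potential of the parity. The names of the new crossings do not matter
  (\<open>finger_value_eq\<close>).\<close>

definition finger_value :: "(diagram \<Rightarrow> nat \<Rightarrow> 'a) \<Rightarrow> diagram \<Rightarrow> nat \<times> bool \<Rightarrow> 'a" where
  "finger_value p D d = (SOME t. \<exists>a b. fresh D a b \<and> t = p (finger D d a b) b)"

text \<open>The difference of a potential for the two directions of travel is the value of the cycle.\<close>

definition arc_value :: "(diagram \<Rightarrow> nat \<Rightarrow> 'a::ab_group_add) \<Rightarrow> diagram \<Rightarrow> nat \<Rightarrow> 'a" where
  "arc_value p D k = finger_value p D (k, False) - finger_value p D (k, True)"

text \<open>The relation \<open>R2\<close> does not say where the removed passages are. But its first two passages come
  before their opposites, so they must be \<open>x\<close> and \<open>y\<close>.\<close>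

lemma doubling_correspond:
  assumes "R2 E (crossing x) (crossing y) A D" "E = u @ [x, y] @ [opposite x, opposite y] @ w"
  shows "(length u, length u) \<in> A" "(length u + 2, length u) \<in> A"
proof -
  obtain u' x' y' m q w' where E: "E = u' @ [x', y'] @ m @ q @ w'" "crossing x' = crossing x"
    and long: "long_diagram E"
    and q: "q = [opposite x', opposite y'] \<or> q = [opposite y', opposite x']"
    and A: "A = {(k, k) | k. k \<le> length u'} \<union> {(k + 2, k) | k. length u' \<le> k \<and> k \<le> length (u' @ m)} \<union>
       {(k + 4, k) | k. length (u' @ m) \<le> k \<and> k \<le> length (u' @ m @ w')}"
    using assms(1) by (rule R2.cases) (rule that; (assumption | simp only:))
  have x': "length u' < length E" "E ! length u' = x'" by (simp_all add: E(1))
  have x: "length u < length E" "E ! length u = x"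
    "length u + 2 < length E" "E ! (length u + 2) = opposite x"
    by (simp_all add: assms(2) nth_append)
  have "length u' = length u"
  proof (cases "rising x' = rising x")
    case True
    then show ?thesis using long_diagram_rising_unique[OF long x'(1) x(1)] x' x E(2) by simp
  next
    case False
    then have "length u' = length u + 2"
      using long_diagram_rising_unique[OF long x'(1) x(3)] x' x E(2) by simp
    moreover have "opposite x' \<in> set (m @ q @ w')" using q by auto
    then obtain l where "l < length (m @ q @ w')" "(m @ q @ w') ! l = opposite x'"
      by (auto simp only: in_set_conv_nth)
    then have "length u' + 2 + l < length E" "E ! (length u' + 2 + l) = opposite x'"
      by (simp_all add: E(1) nth_append)
    then have "length u' + 2 + l = length u"
      using long_diagram_rising_unique[OF long _ x(1)] x E(2) False by simp
    ultimately show ?thesis by simp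
  qed
  then show "(length u, length u) \<in> A" "(length u + 2, length u) \<in> A"
    by (simp_all add: A)
qed

lemma doubling_exists:
  assumes "long_diagram D" "k \<le> length D"
  shows "\<exists>E v. doubling D k E v"
proof -
  obtain a b where "fresh D a b" using fresh_exists by blast
  then have ab: "a \<noteq> b" "a \<notin> vertices D" "b \<notin> vertices D" by (simp_all add: fresh_def)
  obtain u w where uw: "D = u @ w" "k = length u" using split_at[OF assms(2)] assms(2)
    by (metis append_take_drop_id length_take min.absorb2)
  define x y where "x = Passage a True True" and "y = Passage b True False"
  let ?E = "u @ [x, y] @ [] @ [opposite x, opposite y] @ w"
  have "distinct (map (\<lambda>x. (crossing x, over x)) ?E)"
  proof -
    have "crossing z \<noteq> a \<and> crossing z \<noteq> b" if "z \<in> set u \<union> set w" for z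
      using that ab by (auto simp: vertices_def uw(1))
    then show ?thesis
      using assms(1) ab by (auto simp: long_diagram_def uw(1) x_def y_def)
  qed
  moreover have "opposite z \<in> set ?E" if "z \<in> set ?E" for z
    using that assms(1) by (auto simp: long_diagram_def uw(1))
  ultimately have "long_diagram ?E" unfolding long_diagram_def by blast
  from R2.intros[OF this]
  have "\<exists>A. R2 (u @ [x, y] @ [opposite x, opposite y] @ w) (crossing x) (crossing y) A (u @ w)"
    by (auto simp: x_def y_def)
  then have "doubling (u @ w) (length u) (u @ [x, y] @ [opposite x, opposite y] @ w) (crossing x)"
    using doubling.intros by blast
  then show ?thesis using uw by blast
qed

locale parity_on_knot =
  fixes K :: "diagram set" and p :: "diagram \<Rightarrow> nat \<Rightarrow> 'a::ab_group_add"
  assumes knot: "K \<in> long_virtual_knots" and parity: "oriented_parity K p"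
begin

lemma long: "D \<in> K \<Longrightarrow> long_diagram D"
  using knot_long[OF knot] .

lemma move_value:
  assumes "move D F A D'" "D \<in> K" "(v, v') \<in> F"
  shows "p D v = p D' v'"
proof -
  have "D' \<in> K" using knot_move[OF knot assms(2,1)] .
  then show ?thesis
    using conjunct1[OF parity[unfolded oriented_parity_def]] assms by blast
qed

lemma R1_value:
  assumes "R1 D v A D'" "D \<in> K"
  shows "p D v = 0"
  using parity assms knot_move[OF knot assms(2) move.first[OF assms(1)]]
  unfolding oriented_parity_def by blast

lemma R2_value:
  assumes "R2 D v w A D'" "D \<in> K"
  shows "p D v + p D w = 0"
  using parity assms knot_move[OF knot assms(2) move.second[OF assms(1)]]
  unfolding oriented_parity_def by blast

lemma R3_value:
  assumes "R3 D d1 d2 d3 A D'" "D \<in> K"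
  shows "(\<Sum>d \<leftarrow> [d1, d2, d3]. zscale (triangle_sign D d) (p D (fst (arrival D d)))) = 0"
  using parity assms knot_move[OF knot assms(2) move.third[OF assms(1)]]
  unfolding oriented_parity_def by blast

lemma finger_in_knot:
  assumes "D \<in> K" "fresh D a b" "k \<le> length D"
  shows "finger D (k, f) a b \<in> K"
proof -
  obtain A where "R2 (finger D (k, f) a b) (if f then a else b) (if f then b else a) A D"
    using finger_R2[OF long[OF assms(1)] assms(2,3)] by metis
  from move.inverse[OF move.second[OF this]] show ?thesis
    using knot_move[OF knot assms(1)] by blast
qed

lemma finger_value_eq:
  assumes "D \<in> K" "fresh D a b" "k \<le> length D"
  shows "p (finger D (k, f) a b) b = finger_value p D (k, f)"
proof -
  have same: "p (finger D (k, f) a' b') b' = p (finger D (k, f) a b) b" if fr: "fresh D a' b'" for a' b'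
  proof -
    define g where "g = id(a' := a, b' := b)"
    have ab: "a \<noteq> b" "a \<notin> vertices D" "b \<notin> vertices D" "a' \<noteq> b'" "a' \<notin> vertices D" "b' \<notin> vertices D"
      using assms(2) fr by (auto simp: fresh_def)
    have inj: "inj_on g (vertices (finger D (k, f) a' b'))"
      unfolding vertices_finger g_def using ab by (auto simp: inj_on_def)
    have "map (rename g) D = map id D"
    proof (rule map_cong[OF refl])
      fix x assume "x \<in> set D"
      then have "crossing x \<in> vertices D" by (simp add: vertices_def)
      then have "g (crossing x) = crossing x" using ab by (auto simp: g_def)
      then show "rename g x = id x" by (cases x) simp
    qed
    moreover have gab: "g a' = a" "g b' = b" using ab by (simp_all add: g_def)
    ultimately have "map (rename g) (finger D (k, f) a' b') = finger D (k, f) a b"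
      by (simp only: rename_finger list.map_id)
    with move.renaming[OF long_finger[OF long[OF assms(1)] fr] inj]
    have "\<exists>A. move (finger D (k, f) a' b') {(v, g v) | v. v \<in> vertices (finger D (k, f) a' b')} A
        (finger D (k, f) a b)" by metis
    moreover have "(b', b) \<in> {(v, g v) | v. v \<in> vertices (finger D (k, f) a' b')}"
      unfolding vertices_finger using gab by auto
    ultimately show ?thesis
      using move_value finger_in_knot[OF assms(1) fr assms(3)] by blast
  qed
  show ?thesis
    unfolding finger_value_def
    by (rule some_equality[symmetric]) (use same assms(2) in blast)+
qed

lemma finger_value_other:
  assumes "D \<in> K" "fresh D a b" "k \<le> length D"
  shows "p (finger D (k, f) a b) a = - finger_value p D (k, f)"
proof -
  obtain A where "R2 (finger D (k, f) a b) (if f then a else b) (if f then b else a) A D"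
    using finger_R2[OF long[OF assms(1)] assms(2,3)] by metis
  from R2_value[OF this finger_in_knot[OF assms]]
  have "p (finger D (k, f) a b) a + p (finger D (k, f) a b) b = 0"
    by (cases f) (simp_all add: add.commute)
  then show ?thesis using finger_value_eq[OF assms] by (simp add: eq_neg_iff_add_eq_0)
qed

lemma finger_value_move:
  assumes "move D F A D'" "D \<in> K" "(k, k') \<in> A"
  shows "finger_value p D (k, f) = finger_value p D' (k', f)"
proof -
  obtain a b where fr: "fresh D a b" "fresh D' a b" using fresh_exists by blast
  have k: "k \<le> length D" "k' \<le> length D'"
    using move_properties(4)[OF assms(1)] assms(3) by (auto simp: arcs_def)
  have D': "D' \<in> K" using knot_move[OF knot assms(2,1)] .
  obtain F' A' where "move (finger D (k, f) a b) F' A' (finger D' (k', f) a b)" "(b, b) \<in> F'"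
    using move_finger[OF assms(1,3) fr] by blast
  from move_value[OF this(1) finger_in_knot[OF assms(2) fr(1) k(1)] this(2)]
  show ?thesis using finger_value_eq[OF assms(2) fr(1) k(1)] finger_value_eq[OF D' fr(2) k(2)] by simp
qed

lemma finger_keeps_value:
  assumes "D \<in> K" "fresh D a b" "k \<le> length D" "v \<in> vertices D"
  shows "p (finger D (k, f) a b) v = p D v"
proof -
  obtain A where "R2 (finger D (k, f) a b) (if f then a else b) (if f then b else a) A D"
    using finger_R2[OF long[OF assms(1)] assms(2,3)] by metis
  from move_value[OF move.second[OF this] finger_in_knot[OF assms(1-3)], of v v] assms(4)
  show ?thesis by auto
qed

text \<open>This is (P3+) for the triangle of \<open>double_finger\<close>. At the two vertices other than \<open>v\<close> the
  parity is the potential up to sign. The second finger is made in the presence of the first one,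
  but removing the first one does not change its value.\<close>

lemma face_relation:
  assumes D: "D \<in> K" and v: "v \<in> vertices D"
  shows "zscale (corner_sign h) (p D v) =
    finger_value p D (toward D v h) - finger_value p D (away D v (clockwise h))"
proof -
  note longD = long[OF D]
  define k f where "k = arc_at D v h" and "f \<longleftrightarrow> \<not> outgoing h"
  have d: "toward D v h = (k, f)" by (simp add: toward_def k_def f_def)
  have k: "k \<le> length D" using arc_at_in_arcs[OF longD v] by (simp add: k_def arcs_def)
  obtain a b where fr: "fresh D a b" using fresh_exists by blast
  define E where "E = finger D (k, f) a b"
  have E: "E \<in> K" "v \<in> vertices E" "a \<in> vertices E" "b \<in> vertices E"
    using finger_in_knot[OF D fr k] v unfolding E_def vertices_finger by auto
  define k' f' where "k' = arc_at E v (clockwise h)" and "f' \<longleftrightarrow> outgoing (clockwise h)"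
  have e: "away E v (clockwise h) = (k', f')" by (simp add: away_def k'_def f'_def)
  have k': "k' \<le> length E"
    using arc_at_in_arcs[OF long[OF E(1)] E(2)] by (simp add: k'_def arcs_def)
  obtain a' b' where fr': "fresh E a' b'" using fresh_exists by blast
  define E' where "E' = finger E (k', f') a' b'"
  have E': "E' \<in> K" "v \<in> vertices E'" "a \<in> vertices E'" "b \<in> vertices E'"
      "a' \<in> vertices E'" "b' \<in> vertices E'"
    using finger_in_knot[OF E(1) fr' k'] E unfolding E'_def vertices_finger by auto
  define d1 d2 d3 where "d1 = toward E' v h"
    and "d2 = (if outgoing (clockwise h) then toward E' b' SW else toward E' a' NW)"
    and "d3 = (if outgoing h then toward E' b SE else toward E' a SW)"
  obtain A E'' where R3: "R3 E' d1 d2 d3 A E''"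
    using double_finger[OF longD v fr, of h a' b'] fr'
    unfolding d e E_def[symmetric] E'_def[symmetric] d1_def d2_def d3_def by blast
  have keep: "p E' t = p E t" if "t \<in> vertices E" for t
    using finger_keeps_value[OF E(1) fr' k' that] by (simp add: E'_def)
  have pv: "p E' v = p D v"
    using keep[OF E(2)] finger_keeps_value[OF D fr k v] by (simp add: E_def)
  have pab: "p E' b = finger_value p D (k, f)" "p E' a = - finger_value p D (k, f)"
    using keep E(3,4) finger_value_eq[OF D fr k] finger_value_other[OF D fr k]
    by (simp_all add: E_def)
  have pab': "p E' b' = finger_value p E (k', f')" "p E' a' = - finger_value p E (k', f')"
    using finger_value_eq[OF E(1) fr' k'] finger_value_other[OF E(1) fr' k']
    by (simp_all add: E'_def)
  have value_e: "finger_value p E (k', f') = finger_value p D (away D v (clockwise h))"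
  proof -
    obtain B where R2: "R2 E (if f then a else b) (if f then b else a) B D"
      and B: "\<And>i. i \<le> k \<Longrightarrow> (i + 2, i) \<in> B" "\<And>i. k \<le> i \<Longrightarrow> i \<le> length D \<Longrightarrow> (i + 4, i) \<in> B"
      using finger_R2[OF longD fr k] unfolding E_def by metis
    have "(k', arc_at D v (clockwise h)) \<in> B"
      unfolding k'_def E_def by (rule arc_at_finger_correspond[OF B longD fr k v])
    then show ?thesis
      using finger_value_move[OF move.second[OF R2] E(1)] by (simp add: away_def f'_def)
  qed
  have "zscale (triangle_sign E' d1) (p E' (fst (arrival E' d1))) = zscale (corner_sign h) (p D v)"
    using arrival_toward[OF long[OF E'(1)] E'(2)] by (simp add: d1_def triangle_sign_eq pv)
  moreover have "zscale (triangle_sign E' d2) (p E' (fst (arrival E' d2))) = finger_value p E (k', f')"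
    using arrival_toward[OF long[OF E'(1)]] E'(5,6)
    by (simp add: d2_def triangle_sign_eq pab' corner_sign_def)
  moreover have "zscale (triangle_sign E' d3) (p E' (fst (arrival E' d3))) = - finger_value p D (k, f)"
    using arrival_toward[OF long[OF E'(1)]] E'(3,4)
    by (simp add: d3_def triangle_sign_eq pab corner_sign_def)
  ultimately have "zscale (corner_sign h) (p D v) +
      (finger_value p E (k', f') - finger_value p D (k, f)) = 0"
    using R3_value[OF R3 E'(1)] by simp
  then show ?thesis unfolding d value_e by (simp add: eq_neg_iff_add_eq_0[symmetric])
qed

lemma face_relations:
  assumes "D \<in> K" "v \<in> vertices D"
  shows "p D v = finger_value p D (arc_at D v SW, True) - finger_value p D (arc_at D v NW, True)"
    and "p D v = finger_value p D (arc_at D v NE, False) - finger_value p D (arc_at D v SE, False)"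
    and "p D v = finger_value p D (arc_at D v NE, True) - finger_value p D (arc_at D v NW, False)"
    and "p D v = finger_value p D (arc_at D v SW, False) - finger_value p D (arc_at D v SE, True)"
proof -
  show "p D v = finger_value p D (arc_at D v SW, True) - finger_value p D (arc_at D v NW, True)"
    "p D v = finger_value p D (arc_at D v NE, False) - finger_value p D (arc_at D v SE, False)"
    using face_relation[OF assms, of SW] face_relation[OF assms, of NE]
    by (simp_all add: toward_def away_def corner_sign_def del: arc_at.simps)
  have "- p D v = finger_value p D (arc_at D v NW, False) - finger_value p D (arc_at D v NE, True)"
    "- p D v = finger_value p D (arc_at D v SE, True) - finger_value p D (arc_at D v SW, False)"
    using face_relation[OF assms, of NW] face_relation[OF assms, of SE]
    by (simp_all add: toward_def away_def corner_sign_def del: arc_at.simps)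
  then show "p D v = finger_value p D (arc_at D v NE, True) - finger_value p D (arc_at D v NW, False)"
    "p D v = finger_value p D (arc_at D v SW, False) - finger_value p D (arc_at D v SE, True)"
    by (metis minus_diff_eq minus_minus)+
qed


section \<open>The cycle of an oriented parity\<close>

text \<open>The incoming ends of the new crossing lie on arcs that correspond to \<open>k\<close>. So the face relation
  for the sector below it compares the two directions of travel along \<open>k\<close>.\<close>

lemma doubling_value:
  assumes "doubling D k E v" "D \<in> K"
  shows "p E v = arc_value p D k"
  using assms(1)
proof cases
  case (1 u x y w A)
  have R2: "R2 E (crossing x) (crossing y) A D" using 1 by simp
  have E: "E \<in> K" using knot_move[OF knot assms(2) move.inverse[OF move.second[OF R2]]] .
  have A: "(k, k) \<in> A" "(k + 2, k) \<in> A"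
    using doubling_correspond[OF R2] 1 by simp_all
  have "position E v (rising x) = k" "position E v (\<not> rising x) = k + 2"
    by (rule position_eqI[OF long[OF E]]; simp add: 1 nth_append)+
  then have "(arc_at E v SW, k) \<in> A" "(arc_at E v SE, k) \<in> A"
    using A by (cases "rising x"; simp)+
  then have "finger_value p E (arc_at E v SW, False) = finger_value p D (k, False)"
    "finger_value p E (arc_at E v SE, True) = finger_value p D (k, True)"
    using finger_value_move[OF move.second[OF R2] E] by blast+
  moreover have "v \<in> vertices E" by (simp add: 1 vertices_def)
  ultimately show ?thesis using face_relations(4)[OF E] by (simp add: arc_value_def)
qed

lemma parity_cycle_eq:
  assumes "D \<in> K" "k \<in> arcs D"
  shows "parity_cycle p D k = arc_value p D k"
proof -
  have "k \<le> length D" using assms(2) by (simp add: arcs_def)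
  then obtain E v where "doubling D k E v"
    using doubling_exists[OF long[OF assms(1)]] by blast
  then have "(THE t. \<forall>E v. doubling D k E v \<longrightarrow> p E v = t) = arc_value p D k"
    using doubling_value[OF _ assms(1)] by (intro the_equality) blast+
  then show ?thesis using assms(2) by (simp add: parity_cycle_def)
qed

lemma parity_cycle_at:
  assumes "D \<in> K" "v \<in> vertices D"
  shows "parity_cycle p D (arc_at D v h) =
    finger_value p D (arc_at D v h, False) - finger_value p D (arc_at D v h, True)"
  using parity_cycle_eq[OF assms(1) arc_at_in_arcs[OF long[OF assms(1)] assms(2)]]
  by (simp add: arc_value_def)

text \<open>The face relations in the four sectors express one and the same value \<open>p D v\<close>.\<close>

lemma parity_cycle_H1:
  assumes "D \<in> K"
  shows "parity_cycle p D \<in> H1 D"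
proof -
  have "parity_cycle p D (arc_at D v SW) + parity_cycle p D (arc_at D v SE) =
      parity_cycle p D (arc_at D v NW) + parity_cycle p D (arc_at D v NE)" if v: "v \<in> vertices D" for v
  proof -
    define W where "W h f = finger_value p D (arc_at D v h, f)" for h f
    have "p D v = W SW True - W NW True" "p D v = W NE False - W SE False"
      "p D v = W NE True - W NW False" "p D v = W SW False - W SE True"
      using face_relations[OF assms v] by (simp_all add: W_def)
    then have "W SW True = p D v + W NW True" "W NE False = p D v + W SE False"
      "W NE True = p D v + W NW False" "W SW False = p D v + W SE True"
      by (metis diff_add_cancel)+
    then show ?thesis
      unfolding parity_cycle_at[OF assms v] W_def[symmetric] by simp
  qed
  moreover have "parity_cycle p D \<in> C1 D" by (simp add: C1_def parity_cycle_def)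
  ultimately show ?thesis by (simp add: H1_def)
qed

text \<open>If the first arc is travelled along the line, the two passages through \<open>b\<close> bound a loop without
  other crossings, which a first move removes.\<close>

lemma finger_value_start:
  assumes "D \<in> K"
  shows "finger_value p D (0, True) = 0"
proof -
  obtain a b where fr: "fresh D a b" using fresh_exists by blast
  let ?x = "Passage b True False"
  have eq: "finger D (0, True) a b = [Passage a True True] @ [?x, opposite ?x] @ [Passage a False True] @ D"
    by (simp add: finger.simps)
  have "long_diagram (finger D (0, True) a b)" by (rule long_finger[OF long[OF assms] fr])
  then have "\<exists>A D'. R1 (finger D (0, True) a b) b A D'"
    unfolding eq using R1.intros[of "[Passage a True True]" ?x "[Passage a False True] @ D"] by auto
  then have "p (finger D (0, True) a b) b = 0"
    using R1_value finger_in_knot[OF assms fr] by blast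
  then show ?thesis using finger_value_eq[OF assms fr, of 0 True] by simp
qed

text \<open>The face relations in the two sectors on the left of a strand have the same value of \<open>p\<close> with
  opposite signs. Their sum says that the potential in the direction of the line changes by the jump.\<close>

lemma height_parity_cycle:
  assumes D: "D \<in> K" and "k \<le> length D"
  shows "height D (parity_cycle p D) k = finger_value p D (k, True)"
  using assms(2)
proof (induction k)
  case 0
  then show ?case using finger_value_start[OF D] by simp
next
  case (Suc k)
  then have k: "k < length D" by simp
  define v where "v = crossing (D ! k)"
  have v: "v \<in> vertices D" unfolding v_def using k by blast
  have pos: "position D v (rising (D ! k)) = k"
    using position_eqI[OF long[OF D] k] by (simp add: v_def)
  define W where "W h f = finger_value p D (arc_at D v h, f)" for h f
  have W: "W SW True = p D v + W NW True" "W NE True = p D v + W NW False"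
    "W SW False = p D v + W SE True"
    unfolding W_def using face_relations[OF D v] by (metis diff_add_cancel)+
  have "finger_value p D (Suc k, True) = finger_value p D (k, True) + jump D (parity_cycle p D) (D ! k)"
  proof (cases "rising (D ! k)")
    case True
    then have "W SW True = finger_value p D (k, True)" "W NE True = finger_value p D (Suc k, True)"
      using pos by (simp_all add: W_def)
    moreover have "jump D (parity_cycle p D) (D ! k) = W NW False - W NW True"
      using True parity_cycle_at[OF D v, of NW] by (simp add: jump_def v_def W_def)
    moreover have "W NE True = W SW True + (W NW False - W NW True)" unfolding W by simp
    ultimately show ?thesis by simp
  next
    case False
    then have "W SE True = finger_value p D (k, True)" "W NW True = finger_value p D (Suc k, True)"
      using pos by (simp_all add: W_def)
    moreover have "jump D (parity_cycle p D) (D ! k) = - (W SW False - W SW True)"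
      using False parity_cycle_at[OF D v, of SW] by (simp add: jump_def v_def W_def)
    moreover have "W NW True = W SE True + - (W SW False - W SW True)" unfolding W by simp
    ultimately show ?thesis by simp
  qed
  then show ?case using Suc height_Suc[OF k, of "parity_cycle p D"] by simp
qed

lemma parity_index:
  assumes "D \<in> K" "v \<in> vertices D"
  shows "p D v = crossing_index D (parity_cycle p D) v"
proof -
  have "height D (parity_cycle p D) (arc_at D v h) = finger_value p D (arc_at D v h, True)" for h
    using height_parity_cycle[OF assms(1)] arc_at_in_arcs[OF long[OF assms(1)] assms(2)]
    by (simp add: arcs_def)
  then show ?thesis
    unfolding crossing_index_def parity_cycle_at[OF assms] face_relations(4)[OF assms]
    by (simp del: arc_at.simps)
qed

lemma parity_cycle_invariant: "invariant_cycle K (parity_cycle p)"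
  unfolding invariant_cycle_def
proof (intro conjI ballI allI impI)
  show "parity_cycle p D \<in> H1 D" if "D \<in> K" for D by (rule parity_cycle_H1[OF that])
  fix D D' F A and kk
  assume m: "D \<in> K" "D' \<in> K" "move D F A D'" "kk \<in> A"
  obtain k k' where kk: "kk = (k, k')" by force
  have "k \<in> arcs D" "k' \<in> arcs D'" using move_properties(4)[OF m(3)] m(4) kk by auto
  moreover have "arc_value p D k = arc_value p D' k'"
    using finger_value_move[OF m(3,1)] m(4) kk by (simp add: arc_value_def)
  ultimately show "case kk of (k, k') \<Rightarrow> parity_cycle p D k = parity_cycle p D' k'"
    using parity_cycle_eq m(1,2) kk by simp
qed

end

theorem theorem9:
  fixes K :: "diagram set"
  assumes "K \<in> long_virtual_knots"
  shows "(\<forall>p :: diagram \<Rightarrow> nat \<Rightarrow> 'a::ab_group_add. oriented_parity K p \<longrightarrow>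
            invariant_cycle K (parity_cycle p) \<and>
            (\<forall>D \<in> K. \<forall>v \<in> vertices D.
               p D v = zscale (- knot_order D v)
                 (intersection D (closed_half_path D v) (parity_cycle p D)))) \<and>
         (\<forall>\<delta> :: diagram \<Rightarrow> nat \<Rightarrow> 'a. invariant_cycle K \<delta> \<longrightarrow>
            oriented_parity K (cycle_parity \<delta>))"
proof (intro conjI allI impI ballI)
  fix p :: "diagram \<Rightarrow> nat \<Rightarrow> 'a"
  assume "oriented_parity K p"
  then interpret parity_on_knot K p by (rule parity_on_knot.intro[OF assms])
  show "invariant_cycle K (parity_cycle p)" by (rule parity_cycle_invariant)
  show "p D v = zscale (- knot_order D v) (intersection D (closed_half_path D v) (parity_cycle p D))"
    if "D \<in> K" "v \<in> vertices D" for D v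
    unfolding intersection_closed_half[OF long[OF that(1)] that(2)] by (rule parity_index[OF that])
next
  fix \<delta> :: "diagram \<Rightarrow> nat \<Rightarrow> 'a"
  assume "invariant_cycle K \<delta>"
  then show "oriented_parity K (cycle_parity \<delta>)" by (rule cycle_parity_oriented[OF assms])
qed

end
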